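(* In the affine Brauer category $\mathcal{AB}$ the following identities of formal series in $u^{-1}$ hold (coefficientwise). (1) $\beta_l(u)=-\beta_r(-u)$ and $\beta_l(u)\,\beta_r(u)=-1_{\mathbf 1}$. (2) $$(I\otimes \mathrm{cap})\circ(s\otimes y(u))\circ(I\otimes \mathrm{cup})=\left(1-\tfrac1{2u}\right) w(u)\otimes\beta_r(u)-\tfrac1{2u}\,y(u),$$ $$(\mathrm{cap}\otimes I)\circ(y(u)\otimes s)\circ(\mathrm{cup}\otimes I)=-\left(1+\tfrac1{2u}\right)\beta_l(u)\otimes w(u)+\tfrac1{2u}\,y(u).$$ (3) $$(I\otimes \mathrm{cap})\circ(s\otimes w(u))\circ(I\otimes \mathrm{cup})=-\left(1+\tfrac1{2u}\right) y(u)\otimes\beta_l(u)+\tfrac1{2u}\,w(u),$$ $$(\mathrm{cap}\otimes I)\circ(w(u)\otimes s)\circ(\mathrm{cup}\otimes I)=\left(1-\tfrac1{2u}\right)\beta_r(u)\otimes y(u)-\tfrac1{2u}\,w(u).$$ (4) $$\beta_r(u)\otimes I=\frac{1-(u+x)^{-2}}{1-(u-x)^{-2}}\otimes\beta_r(u),\qquad \beta_l(u)\otimes I=\frac{1-(u-x)^{-2}}{1-(u+x)^{-2}}\otimes\beta_l(u).$$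
   Context: $\Bbbk$ is a commutative ring in which $2$ is invertible. The affine Brauer category $\mathcal{AB}$ is the strict $\Bbbk$-linear monoidal category (unit object $\mathbf 1$) generated by one object $B$ and morphisms $\mathrm{cap}\colon B\otimes B\to\mathbf 1$, $\mathrm{cup}\colon\mathbf 1\to B\otimes B$, $s\colon B\otimes B\to B\otimes B$, $x\colon B\to B$ (the dot), subject to the relations (with $I=1_B$): $s\circ s=1_{B\otimes B}$; $(s\otimes I)(I\otimes s)(s\otimes I)=(I\otimes s)(s\otimes I)(I\otimes s)$; $(I\otimes \mathrm{cap})(\mathrm{cup}\otimes I)=I=(\mathrm{cap}\otimes I)(I\otimes\mathrm{cup})$; $\mathrm{cap}\circ s=\mathrm{cap}$; $(I\otimes\mathrm{cap})(s\otimes I)=(\mathrm{cap}\otimes I)(I\otimes s)$; $(x\otimes I)s-s(I\otimes x)=1_{B\otimes B}-\mathrm{cup}\circ\mathrm{cap}$; $\mathrm{cap}(x\otimes I)=-\mathrm{cap}(I\otimes x)$. Power series in $u^{-1}$ with coefficients in $\Bbbk[x]$ are regarded as power series with coefficients in $\mathrm{End}(B)$, and rational functions are expanded as Laurent series in $u^{-1}$ at $u=\infty$. Set $y(u)=(u-x)^{-1}=\sum_{n\ge0}x^nu^{-n-1}$ and $w(u)=(u+x)^{-1}=\sum_{n\ge0}(-x)^nu^{-n-1}$. Define the following elements of $\mathrm{End}(\mathbf 1)[[u^{-1}]]$: $$\beta_r(u)=1_{\mathbf 1}+\tfrac{2u}{2u-1}\,\mathrm{cap}\circ(I\otimes y(u))\circ\mathrm{cup},\qquad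 \beta_l(u)=-1_{\mathbf 1}+\tfrac{2u}{2u+1}\,\mathrm{cap}\circ(y(u)\otimes I)\circ\mathrm{cup}.$$ *)

theory Defs
  imports "HOL-Computational_Algebra.Computational_Algebra"
begin

section \<open>The affine Brauer category\<close>

text \<open>
  The objects of the category are the tensor powers of the generating object; the \<open>n\<close>-th power
  is represented by the natural number \<open>n\<close>, so that the unit object is \<open>0\<close>, the generating object
  is \<open>1\<close>, and the tensor product of objects is addition.  The morphisms are well-formed terms in
  the generators, modulo the congruence generated by the axioms of a strict linear monoidal
  category and the defining relations.
\<close>

datatype 'k ab_term =
    Idn nat
  | Cap
  | Cup
  | Cross
  | Dot
  | Null nat nat
  | Plus "'k ab_term" "'k ab_term"
  | Scale 'k "'k ab_term"
  | Comp "'k ab_term" "'k ab_term"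
  | Tensor "'k ab_term" "'k ab_term"

fun tsrc :: "'k ab_term \<Rightarrow> nat" where
  "tsrc (Idn n) = n"
| "tsrc Cap = 2"
| "tsrc Cup = 0"
| "tsrc Cross = 2"
| "tsrc Dot = 1"
| "tsrc (Null m n) = m"
| "tsrc (Plus f g) = tsrc f"
| "tsrc (Scale c f) = tsrc f"
| "tsrc (Comp f g) = tsrc g"
| "tsrc (Tensor f g) = tsrc f + tsrc g"

fun ttgt :: "'k ab_term \<Rightarrow> nat" where
  "ttgt (Idn n) = n"
| "ttgt Cap = 0"
| "ttgt Cup = 2"
| "ttgt Cross = 2"
| "ttgt Dot = 1"
| "ttgt (Null m n) = n"
| "ttgt (Plus f g) = ttgt f"
| "ttgt (Scale c f) = ttgt f"
| "ttgt (Comp f g) = ttgt f"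
| "ttgt (Tensor f g) = ttgt f + ttgt g"

fun wf_term :: "'k ab_term \<Rightarrow> bool" where
  "wf_term (Plus f g) \<longleftrightarrow> wf_term f \<and> wf_term g \<and> tsrc f = tsrc g \<and> ttgt f = ttgt g"
| "wf_term (Scale c f) \<longleftrightarrow> wf_term f"
| "wf_term (Comp f g) \<longleftrightarrow> wf_term f \<and> wf_term g \<and> tsrc f = ttgt g"
| "wf_term (Tensor f g) \<longleftrightarrow> wf_term f \<and> wf_term g"
| "wf_term _ \<longleftrightarrow> True"

text \<open>
  These equations are imposed below only where both sides are well-formed.  In particular the
  interchange law is restricted to the case where all composites in it exist.
\<close>

inductive slm_axiom :: "'k::comm_ring_1 ab_term \<Rightarrow> 'k ab_term \<Rightarrow> bool" where
  plus_assoc: "slm_axiom (Plus (Plus f g) h) (Plus f (Plus g h))"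
| plus_comm: "slm_axiom (Plus f g) (Plus g f)"
| plus_null: "slm_axiom (Plus f (Null (tsrc f) (ttgt f))) f"
| scale_zero: "slm_axiom (Scale 0 f) (Null (tsrc f) (ttgt f))"
| scale_one: "slm_axiom (Scale 1 f) f"
| scale_scale: "slm_axiom (Scale a (Scale b f)) (Scale (a * b) f)"
| scale_add: "slm_axiom (Scale (a + b) f) (Plus (Scale a f) (Scale b f))"
| scale_plus: "slm_axiom (Scale a (Plus f g)) (Plus (Scale a f) (Scale a g))"
| comp_assoc: "slm_axiom (Comp (Comp f g) h) (Comp f (Comp g h))"
| comp_idn_left: "slm_axiom (Comp (Idn (ttgt f)) f) f"
| comp_idn_right: "slm_axiom (Comp f (Idn (tsrc f))) f"
| comp_plus_left: "slm_axiom (Comp (Plus f g) h) (Plus (Comp f h) (Comp g h))"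
| comp_plus_right: "slm_axiom (Comp f (Plus g h)) (Plus (Comp f g) (Comp f h))"
| comp_scale_left: "slm_axiom (Comp (Scale a f) g) (Scale a (Comp f g))"
| comp_scale_right: "slm_axiom (Comp f (Scale a g)) (Scale a (Comp f g))"
| tensor_assoc: "slm_axiom (Tensor (Tensor f g) h) (Tensor f (Tensor g h))"
| tensor_unit_left: "slm_axiom (Tensor (Idn 0) f) f"
| tensor_unit_right: "slm_axiom (Tensor f (Idn 0)) f"
| tensor_idn: "slm_axiom (Tensor (Idn m) (Idn n)) (Idn (m + n))"
| interchange: "slm_axiom (Comp (Tensor f g) (Tensor h k)) (Tensor (Comp f h) (Comp g k))"
| tensor_plus_left: "slm_axiom (Tensor (Plus f g) h) (Plus (Tensor f h) (Tensor g h))"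
| tensor_plus_right: "slm_axiom (Tensor f (Plus g h)) (Plus (Tensor f g) (Tensor f h))"
| tensor_scale_left: "slm_axiom (Tensor (Scale a f) g) (Scale a (Tensor f g))"
| tensor_scale_right: "slm_axiom (Tensor f (Scale a g)) (Scale a (Tensor f g))"

abbreviation (input) Strand :: "'k ab_term" where
  "Strand \<equiv> Idn 1"

inductive ab_relation :: "'k::comm_ring_1 ab_term \<Rightarrow> 'k ab_term \<Rightarrow> bool" where
  cross_cross: "ab_relation (Comp Cross Cross) (Idn 2)"
| braid: "ab_relation
    (Comp (Comp (Tensor Cross Strand) (Tensor Strand Cross)) (Tensor Cross Strand))
    (Comp (Comp (Tensor Strand Cross) (Tensor Cross Strand)) (Tensor Strand Cross))"
| zigzag_left: "ab_relation (Comp (Tensor Strand Cap) (Tensor Cup Strand)) Strand"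
| zigzag_right: "ab_relation (Comp (Tensor Cap Strand) (Tensor Strand Cup)) Strand"
| cap_cross: "ab_relation (Comp Cap Cross) Cap"
| cap_slide: "ab_relation
    (Comp (Tensor Strand Cap) (Tensor Cross Strand))
    (Comp (Tensor Cap Strand) (Tensor Strand Cross))"
| dot_cross: "ab_relation
    (Plus (Comp (Tensor Dot Strand) Cross) (Scale (- 1) (Comp Cross (Tensor Strand Dot))))
    (Plus (Idn 2) (Scale (- 1) (Comp Cup Cap)))"
| cap_dot: "ab_relation
    (Comp Cap (Tensor Dot Strand)) (Scale (- 1) (Comp Cap (Tensor Strand Dot)))"

inductive ab_eq :: "'k::comm_ring_1 ab_term \<Rightarrow> 'k ab_term \<Rightarrow> bool" where
  ab_axiom: "\<lbrakk>slm_axiom f g; wf_term f; wf_term g\<rbrakk> \<Longrightarrow> ab_eq f g"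
| ab_rel: "ab_relation f g \<Longrightarrow> ab_eq f g"
| ab_refl: "wf_term f \<Longrightarrow> ab_eq f f"
| ab_sym: "ab_eq f g \<Longrightarrow> ab_eq g f"
| ab_trans: "\<lbrakk>ab_eq f g; ab_eq g h\<rbrakk> \<Longrightarrow> ab_eq f h"
| ab_plus: "\<lbrakk>ab_eq f f'; ab_eq g g'; wf_term (Plus f g)\<rbrakk> \<Longrightarrow> ab_eq (Plus f g) (Plus f' g')"
| ab_scale: "ab_eq f f' \<Longrightarrow> ab_eq (Scale a f) (Scale a f')"
| ab_comp: "\<lbrakk>ab_eq f f'; ab_eq g g'; wf_term (Comp f g)\<rbrakk> \<Longrightarrow> ab_eq (Comp f g) (Comp f' g')"
| ab_tensor: "\<lbrakk>ab_eq f f'; ab_eq g g'\<rbrakk> \<Longrightarrow> ab_eq (Tensor f g) (Tensor f' g')"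

lemma slm_axiom_type:
  assumes "slm_axiom f g" "wf_term f" "wf_term g"
  shows "tsrc f = tsrc g \<and> ttgt f = ttgt g"
  using assms by (induction rule: slm_axiom.induct) auto

lemma ab_relation_type:
  assumes "ab_relation f g"
  shows "wf_term f \<and> wf_term g \<and> tsrc f = tsrc g \<and> ttgt f = ttgt g"
  using assms by (induction rule: ab_relation.induct) auto

lemma ab_eq_type:
  assumes "ab_eq f g"
  shows "wf_term f \<and> wf_term g \<and> tsrc f = tsrc g \<and> ttgt f = ttgt g"
  using assms
proof (induction rule: ab_eq.induct)
  case (ab_axiom f g)
  then show ?case using slm_axiom_type by blast
next
  case (ab_rel f g)
  then show ?case by (rule ab_relation_type)
qed auto

quotient_type (overloaded) 'k ab_mor = "'k::comm_ring_1 ab_term" / partial: ab_eq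
proof (rule part_equivpI)
  show "\<exists>f. ab_eq f f" using ab_refl[of "Idn 0"] by auto
  show "symp ab_eq" by (auto intro: sympI ab_sym)
  show "transp ab_eq" by (auto intro: transpI ab_trans)
qed

lift_definition src :: "'k::comm_ring_1 ab_mor \<Rightarrow> nat" is tsrc
  using ab_eq_type by blast

lift_definition tgt :: "'k::comm_ring_1 ab_mor \<Rightarrow> nat" is ttgt
  using ab_eq_type by blast

definition hom :: "nat \<Rightarrow> nat \<Rightarrow> 'k::comm_ring_1 ab_mor set" where
  "hom m n = {f. src f = m \<and> tgt f = n}"

lift_definition ident :: "nat \<Rightarrow> 'k::comm_ring_1 ab_mor" is Idn
  by (simp add: ab_refl)

lift_definition cap :: "'k::comm_ring_1 ab_mor" is Cap
  by (simp add: ab_refl)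

lift_definition cup :: "'k::comm_ring_1 ab_mor" is Cup
  by (simp add: ab_refl)

lift_definition cross :: "'k::comm_ring_1 ab_mor" is Cross
  by (simp add: ab_refl)

lift_definition dot :: "'k::comm_ring_1 ab_mor" is Dot
  by (simp add: ab_refl)

lift_definition zero_mor :: "nat \<Rightarrow> nat \<Rightarrow> 'k::comm_ring_1 ab_mor" is Null
  by (simp add: ab_refl)

text \<open>
  Addition and composition are partial operations; outside their domain they take the
  meaningless value \<open>ident 0\<close>.
\<close>

lift_definition mor_add :: "'k::comm_ring_1 ab_mor \<Rightarrow> 'k ab_mor \<Rightarrow> 'k ab_mor"
    (infixl "+\<^sub>A" 65)
  is "\<lambda>f g. if tsrc f = tsrc g \<and> ttgt f = ttgt g then Plus f g else Idn 0"
  by (auto simp: ab_eq_type intro!: ab_plus ab_refl dest: ab_eq_type)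

lift_definition mor_scale :: "'k::comm_ring_1 \<Rightarrow> 'k ab_mor \<Rightarrow> 'k ab_mor"
    (infixr "*\<^sub>A" 75)
  is Scale
  by (rule ab_scale)

lift_definition mor_comp :: "'k::comm_ring_1 ab_mor \<Rightarrow> 'k ab_mor \<Rightarrow> 'k ab_mor"
    (infixl "\<circ>\<^sub>A" 70)
  is "\<lambda>f g. if tsrc f = ttgt g then Comp f g else Idn 0"
  using ab_eq_type by (fastforce intro!: ab_comp ab_refl)

lift_definition mor_tensor :: "'k::comm_ring_1 ab_mor \<Rightarrow> 'k ab_mor \<Rightarrow> 'k ab_mor"
    (infixl "\<otimes>\<^sub>A" 80)
  is Tensor
  by (rule ab_tensor)


lemma hom_basic [simp]:
  "src (ident n) = n" "tgt (ident n) = n"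
  "src cap = 2" "tgt cap = 0" "src cup = 0" "tgt cup = 2"
  "src cross = 2" "tgt cross = 2" "src dot = 1" "tgt dot = 1"
  "src (zero_mor m n) = m" "tgt (zero_mor m n) = n"
  "src (a *\<^sub>A f) = src f" "tgt (a *\<^sub>A f) = tgt f"
  "src (f \<otimes>\<^sub>A g) = src f + src g" "tgt (f \<otimes>\<^sub>A g) = tgt f + tgt g"
  by (transfer; simp)+

lemma hom_add [simp]:
  assumes "src f = src g" "tgt f = tgt g"
  shows "src (f +\<^sub>A g) = src f" "tgt (f +\<^sub>A g) = tgt f"
  using assms by (transfer; simp)+

lemma hom_comp [simp]:
  assumes "tgt g = src f"
  shows "src (f \<circ>\<^sub>A g) = src g" "tgt (f \<circ>\<^sub>A g) = tgt f"
  using assms by (transfer; simp)+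

lemma linear_laws:
  "\<lbrakk>src f = src g; tgt f = tgt g; src g = src h; tgt g = tgt h\<rbrakk>
    \<Longrightarrow> (f +\<^sub>A g) +\<^sub>A h = f +\<^sub>A (g +\<^sub>A h)"
  "\<lbrakk>src f = src g; tgt f = tgt g\<rbrakk> \<Longrightarrow> f +\<^sub>A g = g +\<^sub>A f"
  "f +\<^sub>A zero_mor (src f) (tgt f) = f"
  "0 *\<^sub>A f = zero_mor (src f) (tgt f)"
  "1 *\<^sub>A f = f"
  "a *\<^sub>A b *\<^sub>A f = (a * b) *\<^sub>A f"
  "(a + b) *\<^sub>A f = a *\<^sub>A f +\<^sub>A b *\<^sub>A f"
  "\<lbrakk>src f = src g; tgt f = tgt g\<rbrakk> \<Longrightarrow> a *\<^sub>A (f +\<^sub>A g) = a *\<^sub>A f +\<^sub>A a *\<^sub>A g"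
  by (transfer; auto intro!: ab_axiom slm_axiom.intros dest: ab_eq_type)+

lemma comp_laws:
  "\<lbrakk>src f = tgt g; src g = tgt h\<rbrakk> \<Longrightarrow> (f \<circ>\<^sub>A g) \<circ>\<^sub>A h = f \<circ>\<^sub>A (g \<circ>\<^sub>A h)"
  "ident (tgt f) \<circ>\<^sub>A f = f"
  "f \<circ>\<^sub>A ident (src f) = f"
  "\<lbrakk>src f = src g; tgt f = tgt g; src g = tgt h\<rbrakk>
    \<Longrightarrow> (f +\<^sub>A g) \<circ>\<^sub>A h = f \<circ>\<^sub>A h +\<^sub>A g \<circ>\<^sub>A h"
  "\<lbrakk>src g = src h; tgt g = tgt h; src f = tgt g\<rbrakk>
    \<Longrightarrow> f \<circ>\<^sub>A (g +\<^sub>A h) = f \<circ>\<^sub>A g +\<^sub>A f \<circ>\<^sub>A h"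
  "src f = tgt g \<Longrightarrow> (a *\<^sub>A f) \<circ>\<^sub>A g = a *\<^sub>A (f \<circ>\<^sub>A g)"
  "src f = tgt g \<Longrightarrow> f \<circ>\<^sub>A (a *\<^sub>A g) = a *\<^sub>A (f \<circ>\<^sub>A g)"
  by (transfer; auto intro!: ab_axiom slm_axiom.intros dest: ab_eq_type)+

lemma tensor_laws:
  "(f \<otimes>\<^sub>A g) \<otimes>\<^sub>A h = f \<otimes>\<^sub>A (g \<otimes>\<^sub>A h)"
  "ident 0 \<otimes>\<^sub>A f = f"
  "f \<otimes>\<^sub>A ident 0 = f"
  "ident m \<otimes>\<^sub>A ident n = ident (m + n)"
  "\<lbrakk>src f = tgt h; src g = tgt k\<rbrakk>
    \<Longrightarrow> (f \<otimes>\<^sub>A g) \<circ>\<^sub>A (h \<otimes>\<^sub>A k) = (f \<circ>\<^sub>A h) \<otimes>\<^sub>A (g \<circ>\<^sub>A k)"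
  "\<lbrakk>src f = src g; tgt f = tgt g\<rbrakk> \<Longrightarrow> (f +\<^sub>A g) \<otimes>\<^sub>A h = f \<otimes>\<^sub>A h +\<^sub>A g \<otimes>\<^sub>A h"
  "\<lbrakk>src g = src h; tgt g = tgt h\<rbrakk> \<Longrightarrow> f \<otimes>\<^sub>A (g +\<^sub>A h) = f \<otimes>\<^sub>A g +\<^sub>A f \<otimes>\<^sub>A h"
  "(a *\<^sub>A f) \<otimes>\<^sub>A g = a *\<^sub>A (f \<otimes>\<^sub>A g)"
  "f \<otimes>\<^sub>A (a *\<^sub>A g) = a *\<^sub>A (f \<otimes>\<^sub>A g)"
  by (transfer; auto intro!: ab_axiom slm_axiom.intros dest: ab_eq_type)+

lemma defining_relations:
  "cross \<circ>\<^sub>A cross = ident 2"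
  "(cross \<otimes>\<^sub>A ident 1) \<circ>\<^sub>A (ident 1 \<otimes>\<^sub>A cross) \<circ>\<^sub>A (cross \<otimes>\<^sub>A ident 1) =
    (ident 1 \<otimes>\<^sub>A cross) \<circ>\<^sub>A (cross \<otimes>\<^sub>A ident 1) \<circ>\<^sub>A (ident 1 \<otimes>\<^sub>A cross)"
  "(ident 1 \<otimes>\<^sub>A cap) \<circ>\<^sub>A (cup \<otimes>\<^sub>A ident 1) = ident 1"
  "(cap \<otimes>\<^sub>A ident 1) \<circ>\<^sub>A (ident 1 \<otimes>\<^sub>A cup) = ident 1"
  "cap \<circ>\<^sub>A cross = cap"
  "(ident 1 \<otimes>\<^sub>A cap) \<circ>\<^sub>A (cross \<otimes>\<^sub>A ident 1) =
    (cap \<otimes>\<^sub>A ident 1) \<circ>\<^sub>A (ident 1 \<otimes>\<^sub>A cross)"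
  "(dot \<otimes>\<^sub>A ident 1) \<circ>\<^sub>A cross +\<^sub>A (- 1) *\<^sub>A (cross \<circ>\<^sub>A (ident 1 \<otimes>\<^sub>A dot)) =
    ident 2 +\<^sub>A (- 1) *\<^sub>A (cup \<circ>\<^sub>A cap)"
  "cap \<circ>\<^sub>A (dot \<otimes>\<^sub>A ident 1) = (- 1) *\<^sub>A (cap \<circ>\<^sub>A (ident 1 \<otimes>\<^sub>A dot))"
  by (transfer; simp; insert ab_relation.intros, auto intro!: ab_rel)+


section \<open>Formal series in the inverse of \<open>u\<close>\<close>

text \<open>
  Scalar series are of type \<open>'k fps\<close>, the formal variable \<open>fps_X\<close> standing for the inverse of \<open>u\<close>.
  A series with coefficients in a hom space is the function mapping \<open>n\<close> to the coefficient of the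
  \<open>n\<close>-th power of the inverse of \<open>u\<close>.
\<close>

text \<open>
  The coefficient ring is not a field, so the library division of power series is not available.
  The quotient exists and is unique whenever the constant term of the denominator is a unit.
\<close>

definition fps_quot :: "'a::comm_ring_1 fps \<Rightarrow> 'a fps \<Rightarrow> 'a fps" where
  "fps_quot f g = (THE q. q * g = f)"

lemma fps_quot_eqI:
  assumes "g * g' = 1" and "q * g = f"
  shows "fps_quot f g = q"
  unfolding fps_quot_def
proof (rule the_equality)
  fix p assume "p * g = f"
  then have "p * g * g' = q * g * g'" using assms(2) by simp
  then show "p = q" using assms(1) by (simp add: mult.assoc)
qed (rule assms(2))

lemma fps_quot_times:
  assumes "fps_nth g 0 * a = 1"
  shows "fps_quot f g * g = f"
proof -
  have inv: "g * fps_right_inverse g a = 1" using assms by (rule fps_right_inverse)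
  have "(f * fps_right_inverse g a) * g = f * (g * fps_right_inverse g a)"
    by (simp only: mult_ac)
  with inv have "(f * fps_right_inverse g a) * g = f" by simp
  with fps_quot_eqI[OF inv this] show ?thesis by simp
qed

type_synonym 'k ab_series = "nat \<Rightarrow> 'k ab_mor"

primrec add_upto :: "(nat \<Rightarrow> 'k::comm_ring_1 ab_mor) \<Rightarrow> nat \<Rightarrow> 'k ab_mor" where
  "add_upto f 0 = f 0"
| "add_upto f (Suc n) = add_upto f n +\<^sub>A f (Suc n)"

definition const_series :: "'k::comm_ring_1 ab_mor \<Rightarrow> 'k ab_series" ("\<langle>_\<rangle>") where
  "\<langle>f\<rangle> = (\<lambda>n. if n = 0 then f else zero_mor (src f) (tgt f))"

definition series_add :: "'k::comm_ring_1 ab_series \<Rightarrow> 'k ab_series \<Rightarrow> 'k ab_series"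
    (infixl "+\<^sub>S" 65) where
  "f +\<^sub>S g = (\<lambda>n. f n +\<^sub>A g n)"

definition series_uminus :: "'k::comm_ring_1 ab_series \<Rightarrow> 'k ab_series" ("-\<^sub>S _" [81] 80) where
  "-\<^sub>S f = (\<lambda>n. (- 1) *\<^sub>A f n)"

definition series_diff :: "'k::comm_ring_1 ab_series \<Rightarrow> 'k ab_series \<Rightarrow> 'k ab_series"
    (infixl "-\<^sub>S" 65) where
  "f -\<^sub>S g = (\<lambda>n. f n +\<^sub>A (- 1) *\<^sub>A g n)"

definition series_scale :: "'k::comm_ring_1 fps \<Rightarrow> 'k ab_series \<Rightarrow> 'k ab_series"
    (infixr "*\<^sub>S" 75) where
  "c *\<^sub>S f = (\<lambda>n. add_upto (\<lambda>i. fps_nth c i *\<^sub>A f (n - i)) n)"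

definition series_comp :: "'k::comm_ring_1 ab_series \<Rightarrow> 'k ab_series \<Rightarrow> 'k ab_series"
    (infixl "\<circ>\<^sub>S" 70) where
  "f \<circ>\<^sub>S g = (\<lambda>n. add_upto (\<lambda>i. f i \<circ>\<^sub>A g (n - i)) n)"

definition series_tensor :: "'k::comm_ring_1 ab_series \<Rightarrow> 'k ab_series \<Rightarrow> 'k ab_series"
    (infixl "\<otimes>\<^sub>S" 80) where
  "f \<otimes>\<^sub>S g = (\<lambda>n. add_upto (\<lambda>i. f i \<otimes>\<^sub>A g (n - i)) n)"

definition series_neg_arg :: "'k::comm_ring_1 ab_series \<Rightarrow> 'k ab_series" where
  "series_neg_arg f = (\<lambda>n. (- 1) ^ n *\<^sub>A f n)"

primrec dot_power :: "nat \<Rightarrow> 'k::comm_ring_1 ab_mor" where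
  "dot_power 0 = ident 1"
| "dot_power (Suc n) = dot \<circ>\<^sub>A dot_power n"

definition poly_at_dot :: "'k::comm_ring_1 poly \<Rightarrow> 'k ab_mor" where
  "poly_at_dot p = add_upto (\<lambda>i. coeff p i *\<^sub>A dot_power i) (degree p)"

definition at_dot :: "'k::comm_ring_1 poly fps \<Rightarrow> 'k ab_series" where
  "at_dot F = (\<lambda>n. poly_at_dot (fps_nth F n))"

text \<open>The expansions of \<open>y(u) = 1 / (u - x)\<close> and \<open>w(u) = 1 / (u + x)\<close> over the polynomials in \<open>x\<close>:\<close>

definition y_fps :: "'k::comm_ring_1 poly fps" where
  "y_fps = Abs_fps (\<lambda>n. if n = 0 then 0 else monom 1 (n - 1))"

definition w_fps :: "'k::comm_ring_1 poly fps" where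
  "w_fps = Abs_fps (\<lambda>n. if n = 0 then 0 else monom ((- 1) ^ (n - 1)) (n - 1))"

text \<open>Multiplying \<open>u - x\<close> and \<open>u + x\<close> by the inverse of \<open>u\<close> gives the second factors below.\<close>

lemma y_fps_inverse: "y_fps * (1 - fps_const (monom 1 1) * fps_X) = fps_X"
proof (rule fps_ext)
  fix n
  have "y_fps * (1 - fps_const (monom 1 1) * fps_X) =
      y_fps - (y_fps * fps_const (monom 1 1)) * (fps_X :: 'a poly fps)"
    by (simp add: algebra_simps)
  then show "fps_nth (y_fps * (1 - fps_const (monom 1 1) * fps_X)) n = fps_nth (fps_X :: 'a poly fps) n"
    by (cases n rule: nat.exhaust; cases "n - 1")
      (auto simp: y_fps_def mult_monom)
qed

lemma w_fps_inverse: "w_fps * (1 + fps_const (monom 1 1) * fps_X) = fps_X"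
proof (rule fps_ext)
  fix n
  have "w_fps * (1 + fps_const (monom 1 1) * fps_X) =
      w_fps + (w_fps * fps_const (monom 1 1)) * (fps_X :: 'a poly fps)"
    by (simp add: algebra_simps)
  then show "fps_nth (w_fps * (1 + fps_const (monom 1 1) * fps_X)) n = fps_nth (fps_X :: 'a poly fps) n"
    by (cases n rule: nat.exhaust; cases "n - 1")
      (auto simp: w_fps_def mult_monom add_monom)
qed

definition y_ser :: "'k::comm_ring_1 ab_series" where
  "y_ser = at_dot y_fps"

definition w_ser :: "'k::comm_ring_1 ab_series" where
  "w_ser = at_dot w_fps"

text \<open>
  The scalar factors \<open>2 * u / (2 * u - 1)\<close> and \<open>2 * u / (2 * u + 1)\<close> are written with numerator and
  denominator multiplied by the inverse of \<open>u\<close>.  Likewise \<open>1 / (2 * u)\<close> is \<open>fps_quot fps_X 2\<close>.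
\<close>

definition beta_r :: "'k::comm_ring_1 ab_series" where
  "beta_r = \<langle>ident 0\<rangle> +\<^sub>S
    fps_quot 2 (2 - fps_X) *\<^sub>S (\<langle>cap\<rangle> \<circ>\<^sub>S (\<langle>ident 1\<rangle> \<otimes>\<^sub>S y_ser) \<circ>\<^sub>S \<langle>cup\<rangle>)"

definition beta_l :: "'k::comm_ring_1 ab_series" where
  "beta_l = (-\<^sub>S \<langle>ident 0\<rangle>) +\<^sub>S
    fps_quot 2 (2 + fps_X) *\<^sub>S (\<langle>cap\<rangle> \<circ>\<^sub>S (y_ser \<otimes>\<^sub>S \<langle>ident 1\<rangle>) \<circ>\<^sub>S \<langle>cup\<rangle>)"

lemma add_upto_hom: "(\<And>i. i \<le> n \<Longrightarrow> f i \<in> hom k l) \<Longrightarrow> add_upto f n \<in> hom k l"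
  by (induction n) (auto simp: hom_def)

lemma dot_power_hom: "dot_power n \<in> hom 1 1"
  by (induction n) (simp_all add: hom_def)

lemma at_dot_hom: "at_dot F n \<in> hom 1 1"
  unfolding at_dot_def poly_at_dot_def
  by (rule add_upto_hom) (use dot_power_hom in \<open>simp add: hom_def\<close>)

lemma const_series_hom: "f \<in> hom k l \<Longrightarrow> \<langle>f\<rangle> n \<in> hom k l"
  by (auto simp: const_series_def hom_def)

lemma series_scale_hom: "(\<And>n. f n \<in> hom k l) \<Longrightarrow> (c *\<^sub>S f) n \<in> hom k l"
  unfolding series_scale_def by (rule add_upto_hom) (simp add: hom_def)

lemma series_comp_hom:
  "\<lbrakk>\<And>n. f n \<in> hom l m; \<And>n. g n \<in> hom k l\<rbrakk> \<Longrightarrow> (f \<circ>\<^sub>S g) n \<in> hom k m"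
  unfolding series_comp_def by (rule add_upto_hom) (simp add: hom_def)

lemma series_tensor_hom:
  "\<lbrakk>\<And>n. f n \<in> hom k l; \<And>n. g n \<in> hom k' l'\<rbrakk> \<Longrightarrow> (f \<otimes>\<^sub>S g) n \<in> hom (k + k') (l + l')"
  unfolding series_tensor_def by (rule add_upto_hom) (simp add: hom_def)

lemma series_add_hom:
  "\<lbrakk>\<And>n. f n \<in> hom k l; \<And>n. g n \<in> hom k l\<rbrakk> \<Longrightarrow> (f +\<^sub>S g) n \<in> hom k l"
  by (auto simp: series_add_def hom_def)

lemma series_uminus_hom: "(\<And>n. f n \<in> hom k l) \<Longrightarrow> (-\<^sub>S f) n \<in> hom k l"
  by (auto simp: series_uminus_def hom_def)

lemma generator_hom:
  "ident n \<in> hom n n" "cap \<in> hom 2 0" "cup \<in> hom 0 2" "cross \<in> hom 2 2" "dot \<in> hom 1 1"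
  by (auto simp: hom_def)

lemma beta_hom: "beta_r n \<in> hom 0 0" "beta_l n \<in> hom 0 0"
proof -
  have y: "y_ser n \<in> hom 1 1" for n :: nat
    unfolding y_ser_def by (rule at_dot_hom)
  note c = generator_hom[THEN const_series_hom]
  have r: "(\<langle>ident 1\<rangle> \<otimes>\<^sub>S y_ser) n \<in> hom 2 2" and l: "(y_ser \<otimes>\<^sub>S \<langle>ident 1\<rangle>) n \<in> hom 2 2" for n :: nat
    using series_tensor_hom[OF c(1)[of 1] y] series_tensor_hom[OF y c(1)[of 1]]
    by (simp_all add: numeral_2_eq_2)
  show "beta_r n \<in> hom 0 0" unfolding beta_r_def
    by (intro series_add_hom series_scale_hom series_comp_hom[OF series_comp_hom[OF c(2) r] c(3)] c(1))
  show "beta_l n \<in> hom 0 0" unfolding beta_l_def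
    by (intro series_add_hom series_uminus_hom series_scale_hom
        series_comp_hom[OF series_comp_hom[OF c(2) l] c(3)] c(1))
qed

end

theory Submission
  imports Defs
begin

text \<open>
  Put \<open>e = cup \<circ> cap\<close>, let \<open>x\<^sub>i\<close> be the dot on the \<open>i\<close>-th strand, and for a scalar \<open>\<sigma>\<close> let
  \<open>\<tau> = \<sigma> / u\<close> and \<open>G(\<sigma>) = 1 / (1 - \<tau> x)\<close>.  Then \<open>y(u) = G(1) / u\<close> and \<open>w(u) = G(-1) / u\<close>, and replacing
  \<open>u\<close> by \<open>-u\<close> replaces \<open>\<sigma>\<close> by \<open>-\<sigma>\<close>.  An identity that holds for every \<open>\<sigma>\<close> therefore gives both an
  assertion about \<open>y\<close> and \<open>\<beta>\<^sub>r\<close> and the corresponding one about \<open>w\<close> and \<open>\<beta>\<^sub>l\<close>.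

  Three facts about \<open>G\<close> carry the proof.  A dot changes its sign when it passes a cap or a cup, so
  passing a cap or a cup turns \<open>G(\<sigma>)\<close> into \<open>G(-\<sigma>)\<close> (\<open>cap_geo\<close>, \<open>geo_cup\<close>).  The relation between
  dot and crossing says that the crossing intertwines \<open>1 - \<tau> x\<^sub>2\<close> and \<open>1 - \<tau> x\<^sub>1\<close> up to
  \<open>\<tau> (1 - e)\<close>; dividing by these two elements gives
  \<open>s G\<^sub>2 = G\<^sub>1 s - \<tau> G\<^sub>1 (1 - e) G\<^sub>2\<close> (\<open>cross_geo_right\<close>, \<open>cross_geo_left\<close>).  Finally
  \<open>2 G(\<sigma>) G(-\<sigma>) = G(\<sigma>) + G(-\<sigma>)\<close> (\<open>geo_product\<close>).

  Let \<open>L(\<sigma>)\<close> be the closed loop carrying \<open>G(\<sigma>)\<close> on its right arc.  Up to the factor \<open>2 - \<tau>\<close>, the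
  series \<open>\<beta>\<^sub>r\<close> is \<open>2 - \<tau> + 2 \<tau> L(\<sigma>)\<close> at \<open>\<sigma> = 1\<close>, and \<open>-\<beta>\<^sub>l\<close> is the same at \<open>\<sigma> = -1\<close>.
  Pulling \<open>G\<close> through the crossing of a curl leaves three terms: a curl whose loop is free of
  dots, which straightens; a strand next to a loop; and a strand bent by \<open>e\<close> that straightens by the zigzag
  relations and carries \<open>G(\<sigma>) G(-\<sigma>)\<close>.  These are the curl formulas (\<open>curl_right\<close>, \<open>curl_left\<close>).
  Closing the crossing formula by a cap and a cup gives a quadratic relation between \<open>L(\<sigma>)\<close> and
  \<open>L(-\<sigma>)\<close>, which says that the two series are inverse to each other up to sign
  (\<open>bubble_quadratic\<close>).  To move a loop across a strand, write \<open>1 = s\<^sup>2\<close> where the loop meets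
  the strand, pull the loop through, and move \<open>G\<close> through one of the two crossings: the two
  correction terms are curls, which the curl formulas evaluate (\<open>bubble_slide\<close>,
  \<open>beta_num_slide\<close>).

  To calculate with morphisms, whose sums and composites exist only if sources and targets fit, they
  are represented by operators on one abelian group.  These form a ring, and identities between
  series of morphisms become identities between formal power series over that ring.
\<close>

section \<open>Morphisms as operators on an abelian group\<close>

lemma zero_mor_hom [simp]: "zero_mor m n \<in> hom m n"
  by (simp add: hom_def)

lemma scale_hom: "f \<in> hom m n \<Longrightarrow> c *\<^sub>A f \<in> hom m n"
  by (simp add: hom_def)

lemma add_hom: "f \<in> hom m n \<Longrightarrow> g \<in> hom m n \<Longrightarrow> f +\<^sub>A g \<in> hom m n"
  by (simp add: hom_def)

lemma comp_hom: "f \<in> hom l n \<Longrightarrow> g \<in> hom m l \<Longrightarrow> f \<circ>\<^sub>A g \<in> hom m n"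
  by (simp add: hom_def)

lemma tensor_hom: "f \<in> hom m n \<Longrightarrow> g \<in> hom m' n' \<Longrightarrow> f \<otimes>\<^sub>A g \<in> hom (m + m') (n + n')"
  by (simp add: hom_def)

lemma zero_mor_eq: "f \<in> hom m n \<Longrightarrow> zero_mor m n = 0 *\<^sub>A f"
  by (simp add: linear_laws(4) hom_def)

lemma add_zero_mor: "f \<in> hom m n \<Longrightarrow> f +\<^sub>A zero_mor m n = f"
  using linear_laws(3)[of f] by (simp add: hom_def)

lemma zero_mor_add: "f \<in> hom m n \<Longrightarrow> zero_mor m n +\<^sub>A f = f"
  using add_zero_mor[of f m n] linear_laws(2)[of f "zero_mor m n"] by (simp add: hom_def)

lemma add_uminus_mor: "f \<in> hom m n \<Longrightarrow> f +\<^sub>A (- 1) *\<^sub>A f = zero_mor m n"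
  using linear_laws(7)[of 1 "- 1" f] by (simp add: zero_mor_eq[of f m n] linear_laws(5))

lemma scale_zero_mor: "c *\<^sub>A zero_mor m n = zero_mor m n"
  using linear_laws(6)[of c 0 "zero_mor m n"] by (simp add: linear_laws(4))

text \<open>
  The product of all hom spaces.  The additional component \<open>'k\<close> is acted upon by the scalars only: it
  keeps the identity operator different from zero without deciding which hom spaces vanish.
\<close>

typedef (overloaded) 'k rep = "{p :: (nat \<Rightarrow> nat \<Rightarrow> 'k::comm_ring_1 ab_mor) \<times> 'k.
    \<forall>m n. fst p m n \<in> hom m n}"
  by (rule exI[of _ "(zero_mor, 0)"]) simp

setup_lifting type_definition_rep

instantiation rep :: (comm_ring_1) ab_group_add
begin

lift_definition zero_rep :: "'a rep" is "(zero_mor, 0)" by simp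

lift_definition plus_rep :: "'a rep \<Rightarrow> 'a rep \<Rightarrow> 'a rep"
  is "\<lambda>p q. (\<lambda>m n. fst p m n +\<^sub>A fst q m n, snd p + snd q)"
  by (simp add: add_hom)

lift_definition uminus_rep :: "'a rep \<Rightarrow> 'a rep"
  is "\<lambda>p. (\<lambda>m n. (- 1) *\<^sub>A fst p m n, - snd p)"
  by (simp add: scale_hom)

definition minus_rep :: "'a rep \<Rightarrow> 'a rep \<Rightarrow> 'a rep" where "minus_rep p q = p + - q"

instance
proof
  fix a b c :: "'a rep"
  show "a + b + c = a + (b + c)"
    by transfer (simp add: fun_eq_iff hom_def linear_laws(1) add.assoc)
  show "a + b = b + a"
    by transfer (simp add: fun_eq_iff hom_def linear_laws(2) add.commute)
  show "0 + a = a"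
    by transfer (simp add: prod_eq_iff fun_eq_iff zero_mor_add)
  show "- a + a = 0"
  proof transfer
    fix p :: "(nat \<Rightarrow> nat \<Rightarrow> 'a ab_mor) \<times> 'a"
    assume p: "\<forall>m n. fst p m n \<in> hom m n"
    have "(- 1) *\<^sub>A fst p m n +\<^sub>A fst p m n = zero_mor m n" for m n
      using add_uminus_mor[of "fst p m n" m n] linear_laws(2)[of "fst p m n" "(- 1) *\<^sub>A fst p m n"] p
      by (simp add: hom_def)
    then show "(\<lambda>m n. fst (\<lambda>m n. (- 1) *\<^sub>A fst p m n, - snd p) m n +\<^sub>A fst p m n,
        snd (\<lambda>m n. (- 1) *\<^sub>A fst p m n, - snd p) + snd p) = (zero_mor, 0)"
      by auto
  qed
  show "a - b = a + - b" by (rule minus_rep_def)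
qed

end

text \<open>
  Additive operators on the product of the hom spaces, with composition as multiplication.
\<close>

typedef (overloaded) 'k endo =
    "{\<phi> :: 'k::comm_ring_1 rep \<Rightarrow> 'k rep. \<forall>a b. \<phi> (a + b) = \<phi> a + \<phi> b}"
  by (rule exI[of _ id]) simp

setup_lifting type_definition_endo

instantiation endo :: (comm_ring_1) ring_1
begin

lift_definition zero_endo :: "'a endo" is "\<lambda>a. 0" by simp
lift_definition one_endo :: "'a endo" is "\<lambda>a. a" by simp
lift_definition plus_endo :: "'a endo \<Rightarrow> 'a endo \<Rightarrow> 'a endo" is "\<lambda>\<phi> \<psi> a. \<phi> a + \<psi> a"
  by (simp add: algebra_simps)
lift_definition uminus_endo :: "'a endo \<Rightarrow> 'a endo" is "\<lambda>\<phi> a. - \<phi> a"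
  by simp
lift_definition times_endo :: "'a endo \<Rightarrow> 'a endo \<Rightarrow> 'a endo" is "\<lambda>\<phi> \<psi> a. \<phi> (\<psi> a)"
  by simp

definition minus_endo :: "'a endo \<Rightarrow> 'a endo \<Rightarrow> 'a endo" where "minus_endo \<phi> \<psi> = \<phi> + - \<psi>"

instance
proof
  fix \<phi> \<psi> \<chi> :: "'a endo"
  show "\<phi> + \<psi> + \<chi> = \<phi> + (\<psi> + \<chi>)" by transfer (simp add: add.assoc)
  show "\<phi> + \<psi> = \<psi> + \<phi>" by transfer (simp add: add.commute)
  show "0 + \<phi> = \<phi>" by transfer simp
  show "- \<phi> + \<phi> = 0" by transfer simp
  show "\<phi> - \<psi> = \<phi> + - \<psi>" by (rule minus_endo_def)
  show "\<phi> * \<psi> * \<chi> = \<phi> * (\<psi> * \<chi>)" by transfer simp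
  show "1 * \<phi> = \<phi>" by transfer simp
  show "\<phi> * 1 = \<phi>" by transfer simp
  show "(\<phi> + \<psi>) * \<chi> = \<phi> * \<chi> + \<psi> * \<chi>" by transfer simp
  show "\<phi> * (\<psi> + \<chi>) = \<phi> * \<psi> + \<phi> * \<chi>" by transfer simp
  \<comment> \<open>The scalar component separates the two operators.\<close>
  define e where "e = Abs_rep (zero_mor, 1 :: 'a)"
  have "e \<noteq> 0"
    by (simp add: e_def zero_rep_def Abs_rep_inject)
  then have "(\<lambda>a. 0) \<noteq> (\<lambda>a :: 'a rep. a)"
    by (auto dest: fun_cong[where x = e])
  then show "0 \<noteq> (1 :: 'a endo)"
    by transfer
qed

end

text \<open>
  Composition with \<open>f\<close> on the left maps the hom spaces with target \<open>src f\<close> to those with target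
  \<open>tgt f\<close>; all other components are sent to zero.
\<close>

lift_definition post :: "'k::comm_ring_1 ab_mor \<Rightarrow> 'k rep \<Rightarrow> 'k rep"
  is "\<lambda>f p. (\<lambda>m n. if n = tgt f then f \<circ>\<^sub>A fst p m (src f) else zero_mor m n, 0)"
  by (auto simp: hom_def)

lemma post_add: "post f (a + b) = post f a + post f b"
  by (transfer fixing: f)
    (simp add: fun_eq_iff hom_def comp_laws(5) add_zero_mor[OF zero_mor_hom])

lemma post_comp:
  assumes "f \<in> hom l n" "g \<in> hom m l"
  shows "post (f \<circ>\<^sub>A g) a = post f (post g a)"
  using assms by (transfer fixing: f g) (auto simp: fun_eq_iff hom_def comp_laws(1))

lemma post_mor_add:
  assumes "f \<in> hom m n" "g \<in> hom m n"
  shows "post (f +\<^sub>A g) a = post f a + post g a"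
  using assms
  by (transfer fixing: f g) (auto simp: fun_eq_iff hom_def comp_laws(4) add_zero_mor[OF zero_mor_hom])

lift_definition scale_rep :: "'k::comm_ring_1 \<Rightarrow> 'k rep \<Rightarrow> 'k rep"
  is "\<lambda>c p. (\<lambda>m n. c *\<^sub>A fst p m n, c * snd p)"
  by (simp add: scale_hom)

lemma scale_rep_add: "scale_rep c (a + b) = scale_rep c a + scale_rep c b"
  by (transfer fixing: c) (simp add: fun_eq_iff hom_def linear_laws(8) algebra_simps)

lemma post_scale: "post (c *\<^sub>A f) a = scale_rep c (post f a)"
  by (transfer fixing: c f) (simp add: fun_eq_iff hom_def comp_laws(6) scale_zero_mor)

lemma post_scale_rep: "post f (scale_rep c a) = scale_rep c (post f a)"
  by (transfer fixing: c f) (simp add: fun_eq_iff hom_def comp_laws(7) scale_zero_mor)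

lift_definition act :: "'k::comm_ring_1 ab_mor \<Rightarrow> 'k endo" is post
  by (simp add: post_add)

lift_definition scalar :: "'k::comm_ring_1 \<Rightarrow> 'k endo" is scale_rep
  by (simp add: scale_rep_add)

lemma act_comp: "f \<in> hom l n \<Longrightarrow> g \<in> hom m l \<Longrightarrow> act (f \<circ>\<^sub>A g) = act f * act g"
  by (transfer fixing: f g) (auto simp: post_comp)

lemma act_add: "f \<in> hom m n \<Longrightarrow> g \<in> hom m n \<Longrightarrow> act (f +\<^sub>A g) = act f + act g"
  by (transfer fixing: f g) (auto simp: post_mor_add)

lemma act_scale: "act (c *\<^sub>A f) = scalar c * act f"
  by (transfer fixing: c f) (auto simp: post_scale)

lemma act_scalar: "act f * scalar c = scalar c * act f"
  by (transfer fixing: c f) (auto simp: post_scale_rep)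

lemma scale_rep_add_left: "scale_rep (a + b) p = scale_rep a p + scale_rep b p"
  by (transfer fixing: a b) (simp add: linear_laws(7) algebra_simps)

lemma scale_rep_mult: "scale_rep (a * b) p = scale_rep a (scale_rep b p)"
  by (transfer fixing: a b) (simp add: linear_laws(6) algebra_simps)

lemma scale_rep_one: "scale_rep 1 p = p"
  by transfer (simp add: linear_laws(5))

lemma scalar_add: "scalar (a + b) = scalar a + scalar b"
  by (transfer fixing: a b) (simp add: fun_eq_iff scale_rep_add_left)

lemma scalar_mult: "scalar (a * b) = scalar a * scalar b"
  by (transfer fixing: a b) (simp add: fun_eq_iff scale_rep_mult)

lemma scalar_one [simp]: "scalar 1 = 1"
  by transfer (simp add: fun_eq_iff scale_rep_one)

lemma scalar_zero [simp]: "scalar 0 = 0"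
  using scalar_add[of 0 0] by simp

lemma scalar_uminus: "scalar (- a) = - scalar a"
  using scalar_add[of "- a" a] by (simp add: eq_neg_iff_add_eq_0)

text \<open>
  A morphism is recovered from its operator by applying the operator to the identity of its source.
\<close>

lemma act_inject:
  assumes f: "f \<in> hom m n" and g: "g \<in> hom m n" and eq: "act f = act g"
  shows "f = g"
proof -
  define d :: "nat \<Rightarrow> nat \<Rightarrow> 'a ab_mor"
    where "d = (\<lambda>k l. if k = m \<and> l = m then ident m else zero_mor k l)"
  have d: "Rep_rep (Abs_rep (d, 0)) = (d, 0)"
    by (rule Abs_rep_inverse) (auto simp: d_def hom_def)
  from eq have "post f = post g"
    by transfer
  then have "Rep_rep (post f (Abs_rep (d, 0))) = Rep_rep (post g (Abs_rep (d, 0)))"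
    by simp
  then have "fst (Rep_rep (post f (Abs_rep (d, 0)))) m n = fst (Rep_rep (post g (Abs_rep (d, 0)))) m n"
    by simp
  then show ?thesis
    using f g comp_laws(3)[of f] comp_laws(3)[of g]
    by (simp add: post.rep_eq d hom_def) (simp add: d_def)
qed

section \<open>Series of morphisms as power series over the operators\<close>

text \<open>
  Placing identity strands on both sides of a diagram.  By the interchange law these morphisms
  generate all tensor products under composition, so that no tensor product of operators is needed.
\<close>

definition whisker :: "nat \<Rightarrow> 'k::comm_ring_1 ab_mor \<Rightarrow> nat \<Rightarrow> 'k ab_mor" where
  "whisker k f l = ident k \<otimes>\<^sub>A f \<otimes>\<^sub>A ident l"

lemma whisker_hom: "f \<in> hom m n \<Longrightarrow> whisker k f l \<in> hom (k + m + l) (k + n + l)"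
  by (simp add: whisker_def hom_def)

lemma whisker_whisker: "whisker k (whisker i f j) l = whisker (k + i) f (j + l)"
  by (simp add: whisker_def tensor_laws(1) tensor_laws(4))
    (simp add: tensor_laws(1)[symmetric] tensor_laws(4))

lemma whisker_zero [simp]: "whisker 0 f 0 = f"
  by (simp add: whisker_def tensor_laws)

lemma ident_tensor_conv_whisker: "ident k \<otimes>\<^sub>A f = whisker k f 0"
  by (simp add: whisker_def tensor_laws)

lemma tensor_ident_conv_whisker: "f \<otimes>\<^sub>A ident l = whisker 0 f l"
  by (simp add: whisker_def tensor_laws)

lemma whisker_ident: "whisker k (ident j) l = ident (k + j + l)"
  by (simp add: whisker_def tensor_laws)

lemma whisker_comp:
  assumes "f \<in> hom l n" "g \<in> hom m l"
  shows "whisker i (f \<circ>\<^sub>A g) j = whisker i f j \<circ>\<^sub>A whisker i g j"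
proof -
  have "ident n \<circ>\<^sub>A ident n = (ident n :: 'a ab_mor)" for n
    using comp_laws(2)[of "ident n :: 'a ab_mor"] by simp
  with assms show ?thesis
    by (simp add: whisker_def hom_def tensor_laws(5))
qed

lemma whisker_add:
  assumes "f \<in> hom m n" "g \<in> hom m n"
  shows "whisker i (f +\<^sub>A g) j = whisker i f j +\<^sub>A whisker i g j"
  using assms by (simp add: whisker_def hom_def tensor_laws(6,7))

lemma whisker_scale: "whisker i (c *\<^sub>A f) j = c *\<^sub>A whisker i f j"
  by (simp add: whisker_def tensor_laws(8,9))

lemma tensor_eq_comp:
  assumes "f \<in> hom m n" "g \<in> hom m' n'"
  shows "f \<otimes>\<^sub>A g = whisker 0 f n' \<circ>\<^sub>A whisker m g 0"
    and "f \<otimes>\<^sub>A g = whisker n g 0 \<circ>\<^sub>A whisker 0 f m'"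
  using assms comp_laws(2,3)[of f] comp_laws(2,3)[of g]
  by (simp_all add: whisker_def tensor_laws(2,3,5) hom_def)

definition wact :: "nat \<Rightarrow> 'k::comm_ring_1 ab_mor \<Rightarrow> nat \<Rightarrow> 'k endo" where
  "wact k f l = act (whisker k f l)"

lemma wact_comp:
  "f \<in> hom l n \<Longrightarrow> g \<in> hom m l \<Longrightarrow> wact i (f \<circ>\<^sub>A g) j = wact i f j * wact i g j"
  by (simp add: wact_def whisker_comp act_comp[OF whisker_hom whisker_hom])

lemma wact_add: "f \<in> hom m n \<Longrightarrow> g \<in> hom m n \<Longrightarrow> wact i (f +\<^sub>A g) j = wact i f j + wact i g j"
  by (simp add: wact_def whisker_add act_add[OF whisker_hom whisker_hom])

lemma wact_scale: "wact i (c *\<^sub>A f) j = scalar c * wact i f j"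
  by (simp add: wact_def whisker_scale act_scale)

lemma wact_zero [simp]: "wact i (zero_mor m n) j = 0"
  using wact_scale[of i 0 "zero_mor m n" j] by (simp add: linear_laws(4))

lemma wact_whisker: "wact k (whisker i f j) l = wact (k + i) f (j + l)"
  by (simp add: wact_def whisker_whisker)

lemma wact_tensor:
  assumes "f \<in> hom m n" "g \<in> hom m' n'"
  shows "wact k (f \<otimes>\<^sub>A g) l = wact k f (n' + l) * wact (k + m) g l"
    and "wact k (f \<otimes>\<^sub>A g) l = wact (k + n) g l * wact k f (m' + l)"
proof -
  have h: "whisker 0 f n' \<in> hom (m + n') (n + n')" "whisker m g 0 \<in> hom (m + m') (m + n')"
    "whisker n g 0 \<in> hom (n + m') (n + n')" "whisker 0 f m' \<in> hom (m + m') (n + m')"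
    using whisker_hom[OF assms(1), of 0] whisker_hom[OF assms(2), of _ 0] by simp_all
  show "wact k (f \<otimes>\<^sub>A g) l = wact k f (n' + l) * wact (k + m) g l"
    by (simp add: tensor_eq_comp(1)[OF assms] wact_comp[OF h(1,2)] wact_whisker)
  show "wact k (f \<otimes>\<^sub>A g) l = wact (k + n) g l * wact k f (m' + l)"
    by (simp add: tensor_eq_comp(2)[OF assms] wact_comp[OF h(3,4)] wact_whisker)
qed

lemma wact_add_upto:
  assumes "\<And>i. i \<le> N \<Longrightarrow> f i \<in> hom m n"
  shows "wact k (add_upto f N) l = (\<Sum>i=0..N. wact k (f i) l)"
  using assms
proof (induction N)
  case (Suc N)
  then have "wact k (add_upto f N +\<^sub>A f (Suc N)) l = wact k (add_upto f N) l + wact k (f (Suc N)) l"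
    by (intro wact_add add_upto_hom) auto
  with Suc show ?case by simp
qed simp

definition ser_hom :: "nat \<Rightarrow> nat \<Rightarrow> 'k::comm_ring_1 ab_series set" where
  "ser_hom m n = {f. \<forall>i. f i \<in> hom m n}"

lemma const_ser_hom: "f \<in> hom m n \<Longrightarrow> \<langle>f\<rangle> \<in> ser_hom m n"
  by (simp add: ser_hom_def const_series_hom)

lemma comp_ser_hom: "f \<in> ser_hom l n \<Longrightarrow> g \<in> ser_hom m l \<Longrightarrow> f \<circ>\<^sub>S g \<in> ser_hom m n"
  unfolding ser_hom_def by (blast intro: series_comp_hom)

lemma add_ser_hom: "f \<in> ser_hom m n \<Longrightarrow> g \<in> ser_hom m n \<Longrightarrow> f +\<^sub>S g \<in> ser_hom m n"
  by (simp add: ser_hom_def series_add_hom)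

lemma uminus_ser_hom: "f \<in> ser_hom m n \<Longrightarrow> -\<^sub>S f \<in> ser_hom m n"
  by (simp add: ser_hom_def series_uminus_hom)

lemma diff_ser_hom: "f \<in> ser_hom m n \<Longrightarrow> g \<in> ser_hom m n \<Longrightarrow> f -\<^sub>S g \<in> ser_hom m n"
  by (simp add: ser_hom_def series_diff_def add_hom scale_hom)

lemma scale_ser_hom: "f \<in> ser_hom m n \<Longrightarrow> c *\<^sub>S f \<in> ser_hom m n"
  by (simp add: ser_hom_def series_scale_hom)

lemma tensor_ser_hom:
  "f \<in> ser_hom m n \<Longrightarrow> g \<in> ser_hom m' n' \<Longrightarrow> p = m + m' \<Longrightarrow> q = n + n' \<Longrightarrow> f \<otimes>\<^sub>S g \<in> ser_hom p q"
  by (simp add: ser_hom_def series_tensor_hom)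

lemma at_dot_ser_hom: "at_dot F \<in> ser_hom 1 1"
  by (simp add: ser_hom_def at_dot_hom[simplified])

text \<open>
  The factor \<open>ops k f l\<close> in a product stands for a slice of a string diagram that has \<open>f\<close> between \<open>k\<close>
  strands on its left and \<open>l\<close> strands on its right; the leftmost factor is the top slice.
\<close>

definition ops :: "nat \<Rightarrow> 'k::comm_ring_1 ab_series \<Rightarrow> nat \<Rightarrow> 'k endo fps" where
  "ops k f l = Abs_fps (\<lambda>i. wact k (f i) l)"

definition scal :: "'k::comm_ring_1 fps \<Rightarrow> 'k endo fps" where
  "scal c = Abs_fps (\<lambda>i. scalar (fps_nth c i))"

lemma ops_nth [simp]: "fps_nth (ops k f l) i = wact k (f i) l"
  by (simp add: ops_def)

lemma scal_nth [simp]: "fps_nth (scal c) i = scalar (fps_nth c i)"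
  by (simp add: scal_def)

lemma ops_inject:
  assumes "f \<in> ser_hom m n" "g \<in> ser_hom m n" "ops 0 f 0 = ops 0 g 0"
  shows "f = g"
proof
  fix i
  from assms(3) have "fps_nth (ops 0 f 0) i = fps_nth (ops 0 g 0) i" by simp
  with assms(1,2) show "f i = g i"
    by (auto simp: wact_def ser_hom_def intro: act_inject)
qed

lemma ops_const: "ops k \<langle>f\<rangle> l = fps_const (wact k f l)"
  by (rule fps_ext) (simp add: const_series_def)

lemma ops_comp:
  "f \<in> ser_hom l n \<Longrightarrow> g \<in> ser_hom m l \<Longrightarrow> ops i (f \<circ>\<^sub>S g) j = ops i f j * ops i g j"
  by (rule fps_ext)
    (simp add: fps_mult_nth series_comp_def ser_hom_def
      wact_add_upto[of _ _ m n] comp_hom[of _ l n _ m] wact_comp[of _ l n _ m])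

lemma ops_add: "f \<in> ser_hom m n \<Longrightarrow> g \<in> ser_hom m n \<Longrightarrow> ops i (f +\<^sub>S g) j = ops i f j + ops i g j"
  by (rule fps_ext) (simp add: series_add_def ser_hom_def wact_add[of _ m n])

lemma ops_uminus: "ops i (-\<^sub>S f) j = - ops i f j"
  by (rule fps_ext) (simp add: series_uminus_def wact_scale scalar_uminus)

lemma ops_diff: "f \<in> ser_hom m n \<Longrightarrow> g \<in> ser_hom m n \<Longrightarrow> ops i (f -\<^sub>S g) j = ops i f j - ops i g j"
  by (rule fps_ext)
    (simp add: series_diff_def ser_hom_def wact_add[of _ m n] scale_hom wact_scale scalar_uminus)

lemma ops_scale: "f \<in> ser_hom m n \<Longrightarrow> ops i (c *\<^sub>S f) j = scal c * ops i f j"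
  by (rule fps_ext)
    (simp add: fps_mult_nth series_scale_def ser_hom_def wact_add_upto[of _ _ m n] scale_hom wact_scale)

lemma ops_tensor:
  assumes "f \<in> ser_hom m n" "g \<in> ser_hom m' n'"
  shows "ops k (f \<otimes>\<^sub>S g) l = ops k f (n' + l) * ops (k + m) g l"
  using assms
  by (intro fps_ext)
    (simp add: fps_mult_nth series_tensor_def ser_hom_def wact_add_upto[of _ _ "m + m'" "n + n'"]
      tensor_hom wact_tensor(1)[of _ m n _ m' n'])

text \<open>
  Both products are the tensor product of \<open>f\<close>, the identity of the \<open>p\<close> strands in between, and \<open>g\<close>.
\<close>

lemma ops_interchange:
  assumes "f \<in> ser_hom m n" "g \<in> ser_hom m' n'"
  shows "ops k f (p + n' + l) * ops (k + m + p) g l = ops (k + n + p) g l * ops k f (p + m' + l)"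
proof (rule fps_ext)
  fix N
  have "wact k (f i) (p + n' + l) * wact (k + m + p) (g j) l
      = wact (k + n + p) (g j) l * wact k (f i) (p + m' + l)" for i j
  proof -
    have f: "f i \<in> hom m n" and g: "whisker p (g j) 0 \<in> hom (p + m') (p + n')"
      using assms whisker_hom[of "g j" m' n' p 0] by (auto simp: ser_hom_def)
    show ?thesis
      using wact_tensor[OF f g, of k l] by (simp add: wact_whisker add_ac)
  qed
  \<comment> \<open>Exchanging the factors also exchanges the roles of the two degrees, so the sum is reversed.\<close>
  moreover have "(\<Sum>i=0..N. wact (k + n + p) (g i) l * wact k (f (N - i)) (p + m' + l))
      = (\<Sum>i=0..N. wact (k + n + p) (g (N - i)) l * wact k (f i) (p + m' + l))"
    by (subst sum.atLeastAtMost_rev) simp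
  ultimately show "fps_nth (ops k f (p + n' + l) * ops (k + m + p) g l) N
      = fps_nth (ops (k + n + p) g l * ops k f (p + m' + l)) N"
    by (simp add: fps_mult_nth)
qed

lemma scal_add: "scal (c + d) = scal c + scal d"
  by (rule fps_ext) (simp add: scalar_add)

lemma scal_uminus: "scal (- c) = - scal c"
  by (rule fps_ext) (simp add: scalar_uminus)

lemma scal_diff: "scal (c - d) = scal c - scal d"
  using scal_add[of c "- d"] by (simp add: scal_uminus)

lemma scalar_sum: "scalar (sum f A) = (\<Sum>i\<in>A. scalar (f i))"
  by (induction A rule: infinite_finite_induct) (simp_all add: scalar_add)

lemma scal_mult: "scal (c * d) = scal c * scal d"
  by (rule fps_ext) (simp add: fps_mult_nth scalar_sum scalar_mult)

lemma scal_one [simp]: "scal 1 = 1"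
  by (rule fps_ext) simp

lemma scal_commute: "scal c * scal d = scal d * scal c"
  by (simp flip: scal_mult add: mult.commute)

lemma ops_scal: "ops k f l * scal c = scal c * ops k f l"
proof (rule fps_ext)
  fix N
  have "(\<Sum>i=0..N. wact k (f i) l * scalar (fps_nth c (N - i)))
      = (\<Sum>i=0..N. scalar (fps_nth c (N - i)) * wact k (f i) l)"
    by (simp add: wact_def act_scalar)
  also have "\<dots> = (\<Sum>i=0..N. scalar (fps_nth c i) * wact k (f (N - i)) l)"
    by (subst sum.atLeastAtMost_rev) simp
  finally show "fps_nth (ops k f l * scal c) N = fps_nth (scal c * ops k f l) N"
    by (simp add: fps_mult_nth)
qed

lemma ops_scal_left: "ops k f l * (scal c * r) = scal c * (ops k f l * r)"
  by (simp add: ops_scal flip: mult.assoc)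

text \<open>
  The identity of \<open>n\<close> strands.  As an operator it is the projection to the hom spaces with target \<open>n\<close>,
  not the unit of the ring of operators.
\<close>

definition idn :: "nat \<Rightarrow> 'k::comm_ring_1 endo fps" where
  "idn n = ops 0 \<langle>ident n\<rangle> 0"

lemma ops_ident: "ops k \<langle>ident n\<rangle> l = idn (k + n + l)"
  by (simp add: idn_def ops_const wact_def whisker_ident)

lemma idn_ops:
  assumes "f \<in> ser_hom m n"
  shows "idn (k + n + l) * ops k f l = ops k f l" "ops k f l * idn (k + m + l) = ops k f l"
proof -
  have "wact k (f i) l = wact k (ident n) l * wact k (f i) l"
    "wact k (f i) l = wact k (f i) l * wact k (ident m) l" for i
    using assms wact_comp[of "ident n" n n "f i" m k l] wact_comp[of "f i" m n "ident m" m k l]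
      comp_laws(2,3)[of "f i"]
    by (auto simp: ser_hom_def hom_def)
  then show "idn (k + n + l) * ops k f l = ops k f l" "ops k f l * idn (k + m + l) = ops k f l"
    by (auto intro!: fps_ext simp flip: ops_ident simp: ops_const)
qed

section \<open>Polynomials in the dot\<close>

lemma act_poly_at_dot:
  assumes "degree p \<le> N"
  shows "act (poly_at_dot p) = (\<Sum>i=0..N. scalar (coeff p i) * act (dot_power i))"
proof -
  have "act (poly_at_dot p) = wact 0 (poly_at_dot p) 0"
    by (simp add: wact_def)
  also have "\<dots> = (\<Sum>i=0..degree p. wact 0 (coeff p i *\<^sub>A dot_power i) 0)"
    unfolding poly_at_dot_def
    by (rule wact_add_upto[of _ _ 1 1]) (intro scale_hom dot_power_hom)
  also have "\<dots> = (\<Sum>i=0..degree p. scalar (coeff p i) * act (dot_power i))"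
    by (simp add: wact_scale) (simp add: wact_def)
  also have "\<dots> = (\<Sum>i=0..N. scalar (coeff p i) * act (dot_power i))"
    using assms by (intro sum.mono_neutral_left) (auto simp: coeff_eq_0)
  finally show ?thesis .
qed

lemma poly_at_dot_hom: "poly_at_dot p \<in> hom 1 1"
  using at_dot_hom[of "fps_const p" 0] by (simp add: at_dot_def)

lemma act_poly_at_dot_add: "act (poly_at_dot (p + q)) = act (poly_at_dot p) + act (poly_at_dot q)"
proof -
  define N where "N = max (degree p) (degree q)"
  have "degree p \<le> N" "degree q \<le> N" "degree (p + q) \<le> N"
    by (simp_all add: N_def degree_add_le)
  then show ?thesis
    by (simp add: act_poly_at_dot scalar_add distrib_right sum.distrib)
qed

lemma act_poly_at_dot_smult: "act (poly_at_dot (smult c p)) = scalar c * act (poly_at_dot p)"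
  by (simp add: act_poly_at_dot[of _ "degree p"] degree_smult_le scalar_mult sum_distrib_left mult.assoc)

lemma act_poly_at_dot_shift: "act (poly_at_dot (pCons 0 p)) = act dot * act (poly_at_dot p)"
proof -
  have hom: "dot \<in> hom 1 1" "dot_power i \<in> hom 1 1" for i
    using generator_hom(5) dot_power_hom by auto
  have "act (poly_at_dot (pCons 0 p))
      = (\<Sum>i=0..Suc (degree p). scalar (coeff (pCons 0 p) i) * act (dot_power i))"
    by (rule act_poly_at_dot) (rule degree_pCons_le)
  also have "\<dots> = (\<Sum>i=0..degree p. scalar (coeff p i) * act (dot_power (Suc i)))"
    by (subst sum.atLeast0_atMost_Suc_shift) (simp del: dot_power.simps)
  also have "\<dots> = (\<Sum>i=0..degree p. act dot * (scalar (coeff p i) * act (dot_power i)))"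
    by (intro sum.cong refl)
      (simp add: act_comp[OF hom] act_scalar flip: mult.assoc)
  also have "\<dots> = act dot * act (poly_at_dot p)"
    by (simp add: act_poly_at_dot[of p "degree p"] sum_distrib_left)
  finally show ?thesis .
qed

lemma act_poly_at_dot_const: "act (poly_at_dot [:c:]) = scalar c * act (ident 1)"
  by (simp add: act_poly_at_dot[of _ 0])

text \<open>
  Horner's scheme: it suffices to treat scalars and the multiplication by the indeterminate.
\<close>

lemma act_poly_at_dot_mult: "act (poly_at_dot (p * q)) = act (poly_at_dot p) * act (poly_at_dot q)"
proof (induction p)
  case 0
  then show ?case by (simp add: act_poly_at_dot[of 0 0])
next
  case (pCons a p)
  have q: "act (poly_at_dot q) = act (ident 1) * act (poly_at_dot q)"
    using act_comp[OF generator_hom(1) poly_at_dot_hom[of q]] comp_laws(2)[of "poly_at_dot q"]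
      poly_at_dot_hom[of q] by (simp add: hom_def)
  have split: "pCons a p = [:a:] + pCons 0 p" by simp
  have "act (poly_at_dot (pCons a p * q)) = scalar a * act (poly_at_dot q)
      + act dot * (act (poly_at_dot p) * act (poly_at_dot q))"
    by (simp add: act_poly_at_dot_add act_poly_at_dot_smult act_poly_at_dot_shift pCons.IH)
  also have "\<dots> = act (poly_at_dot (pCons a p)) * act (poly_at_dot q)"
    by (subst split, subst act_poly_at_dot_add)
      (simp add: act_poly_at_dot_const act_poly_at_dot_shift distrib_right mult.assoc flip: q del: One_nat_def)
  finally show ?case .
qed

lemma poly_at_dot_add: "poly_at_dot (p + q) = poly_at_dot p +\<^sub>A poly_at_dot q"
  by (rule act_inject[OF poly_at_dot_hom])
    (auto intro!: add_hom poly_at_dot_hom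
      simp: act_add[OF poly_at_dot_hom poly_at_dot_hom] act_poly_at_dot_add simp del: One_nat_def)

lemma poly_at_dot_mult: "poly_at_dot (p * q) = poly_at_dot p \<circ>\<^sub>A poly_at_dot q"
  by (rule act_inject[OF poly_at_dot_hom comp_hom[OF poly_at_dot_hom poly_at_dot_hom]])
    (simp add: act_comp[OF poly_at_dot_hom poly_at_dot_hom] act_poly_at_dot_mult)

lemma poly_at_dot_const: "poly_at_dot [:c:] = c *\<^sub>A ident 1"
  by (rule act_inject[OF poly_at_dot_hom, OF scale_hom[OF generator_hom(1)]])
    (simp add: act_poly_at_dot_const act_scale)

lemma poly_at_dot_0: "poly_at_dot 0 = zero_mor 1 1"
  using poly_at_dot_const[of 0] by (simp add: linear_laws(4))

text \<open>
  For fixed \<open>k\<close> and \<open>l\<close> this is a ring homomorphism, with values in the operators on which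
  \<open>idn (k + 1 + l)\<close> is the unit.  Calculations with rational functions of the dot take place in the
  commutative ring of series over the polynomials.
\<close>

definition dots :: "nat \<Rightarrow> 'k::comm_ring_1 poly fps \<Rightarrow> nat \<Rightarrow> 'k endo fps" where
  "dots k F l = ops k (at_dot F) l"

lemma dots_nth: "fps_nth (dots k F l) i = wact k (poly_at_dot (fps_nth F i)) l"
  by (simp add: dots_def at_dot_def)

lemma dots_add: "dots k (F + G) l = dots k F l + dots k G l"
  by (rule fps_ext) (simp add: dots_nth poly_at_dot_add wact_add[OF poly_at_dot_hom poly_at_dot_hom])

lemma dots_uminus: "dots k (- F) l = - dots k F l"
proof -
  have "dots k (0 :: 'a poly fps) l = 0"
    by (rule fps_ext) (simp add: dots_nth poly_at_dot_0)
  then show ?thesis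
    using dots_add[of k "- F" F l] by (simp add: eq_neg_iff_add_eq_0)
qed

lemma dots_diff: "dots k (F - G) l = dots k F l - dots k G l"
  using dots_add[of k F "- G" l] by (simp add: dots_uminus)

lemma wact_poly_sum: "wact k (poly_at_dot (sum f A)) l = (\<Sum>i\<in>A. wact k (poly_at_dot (f i)) l)"
  by (induction A rule: infinite_finite_induct)
    (simp_all add: poly_at_dot_0 poly_at_dot_add wact_add[OF poly_at_dot_hom poly_at_dot_hom])

lemma dots_mult: "dots k (F * G) l = dots k F l * dots k G l"
  by (rule fps_ext)
    (simp add: dots_nth fps_mult_nth wact_poly_sum poly_at_dot_mult wact_comp[OF poly_at_dot_hom poly_at_dot_hom])

lemma dots_one: "dots k 1 l = idn (k + 1 + l)"
proof -
  have "poly_at_dot 1 = (ident 1 :: 'a ab_mor)"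
    using poly_at_dot_const[of 1] by (simp add: linear_laws(5) one_pCons)
  then show ?thesis
    unfolding ops_ident[symmetric]
    by (intro fps_ext) (simp add: dots_nth poly_at_dot_0 const_series_def)
qed

lemma dots_commute: "dots k F l * dots k G l = dots k G l * dots k F l"
  by (simp flip: dots_mult add: mult.commute)

section \<open>Relations between the operators of the generators\<close>

lemma interchange:
  assumes "f \<in> ser_hom m n" "g \<in> ser_hom m' n'"
    and "a = p + n' + l" "b = k + m + p" "c = k + n + p" "d = p + m' + l"
  shows "ops k f a * ops b g l = ops c g l * ops k f d"
  using ops_interchange[OF assms(1,2), of k p l] by (simp add: assms(3-6))

lemma gen_ser_hom:
  "\<langle>ident n\<rangle> \<in> ser_hom n n" "\<langle>cap\<rangle> \<in> ser_hom 2 0" "\<langle>cup\<rangle> \<in> ser_hom 0 2"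
  "\<langle>cross\<rangle> \<in> ser_hom 2 2" "\<langle>dot\<rangle> \<in> ser_hom 1 1"
  by (intro const_ser_hom generator_hom)+

abbreviation cap_op :: "nat \<Rightarrow> nat \<Rightarrow> 'k::comm_ring_1 endo fps" where "cap_op k l \<equiv> ops k \<langle>cap\<rangle> l"
abbreviation cup_op :: "nat \<Rightarrow> nat \<Rightarrow> 'k::comm_ring_1 endo fps" where "cup_op k l \<equiv> ops k \<langle>cup\<rangle> l"
abbreviation cross_op :: "nat \<Rightarrow> nat \<Rightarrow> 'k::comm_ring_1 endo fps" where "cross_op k l \<equiv> ops k \<langle>cross\<rangle> l"
abbreviation dot_op :: "nat \<Rightarrow> nat \<Rightarrow> 'k::comm_ring_1 endo fps" where "dot_op k l \<equiv> ops k \<langle>dot\<rangle> l"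

lemma ops_const_comp:
  "src f = tgt g \<Longrightarrow> ops k \<langle>f \<circ>\<^sub>A g\<rangle> l = ops k \<langle>f\<rangle> l * ops k \<langle>g\<rangle> l"
  by (simp add: ops_const wact_comp[of f "src f" "tgt f" g "src g"] hom_def)

lemma ops_const_add:
  "src f = src g \<Longrightarrow> tgt f = tgt g \<Longrightarrow> ops k \<langle>f +\<^sub>A g\<rangle> l = ops k \<langle>f\<rangle> l + ops k \<langle>g\<rangle> l"
  by (simp add: ops_const wact_add[of f "src f" "tgt f" g] hom_def)

lemma ops_const_uminus: "ops k \<langle>(- 1) *\<^sub>A f\<rangle> l = - ops k \<langle>f\<rangle> l"
  by (simp add: ops_const wact_scale scalar_uminus flip: fps_const_neg)

lemma ops_const_tensor:
  "ops k \<langle>ident i \<otimes>\<^sub>A f\<rangle> l = ops (k + i) \<langle>f\<rangle> l"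
  "ops k \<langle>f \<otimes>\<^sub>A ident j\<rangle> l = ops k \<langle>f\<rangle> (j + l)"
  by (simp_all add: ops_const ident_tensor_conv_whisker tensor_ident_conv_whisker wact_whisker)

lemmas ops_const_simps = ops_const_comp ops_const_add ops_const_uminus ops_const_tensor ops_ident

lemma zigzag_left_ops: "cap_op (Suc k) l * cup_op k (Suc l) = idn (Suc (k + l))"
  using arg_cong[OF defining_relations(3), of "\<lambda>f. ops k \<langle>f\<rangle> l"] by (simp add: ops_const_simps)

lemma zigzag_right_ops: "cap_op k (Suc l) * cup_op (Suc k) l = idn (Suc (k + l))"
  using arg_cong[OF defining_relations(4), of "\<lambda>f. ops k \<langle>f\<rangle> l"] by (simp add: ops_const_simps)

lemma cross_cross_ops: "cross_op k l * cross_op k l = idn (Suc (Suc (k + l)))"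
  using arg_cong[OF defining_relations(1), of "\<lambda>f. ops k \<langle>f\<rangle> l"] by (simp add: ops_const_simps)

lemma cap_cross_ops: "cap_op k l * cross_op k l = cap_op k l"
  using arg_cong[OF defining_relations(5), of "\<lambda>f. ops k \<langle>f\<rangle> l"] by (simp add: ops_const_simps)

lemma cap_slide_ops: "cap_op (Suc k) l * cross_op k (Suc l) = cap_op k (Suc l) * cross_op (Suc k) l"
  using arg_cong[OF defining_relations(6), of "\<lambda>f. ops k \<langle>f\<rangle> l"] by (simp add: ops_const_simps)

lemma dot_cross_ops:
  "dot_op k (Suc l) * cross_op k l = cross_op k l * dot_op (Suc k) l + idn (Suc (Suc (k + l))) - cup_op k l * cap_op k l"
  using arg_cong[OF defining_relations(7), of "\<lambda>f. ops k \<langle>f\<rangle> l"]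
  by (simp add: ops_const_simps algebra_simps)

lemma cap_dot_ops: "cap_op k l * dot_op k (Suc l) = - (cap_op k l * dot_op (Suc k) l)"
  using arg_cong[OF defining_relations(8), of "\<lambda>f. ops k \<langle>f\<rangle> l"] by (simp add: ops_const_simps)

lemma idn_gen [simp]:
  "p = k + l \<Longrightarrow> idn p * cap_op k l = cap_op k l"
  "p = Suc (Suc (k + l)) \<Longrightarrow> cap_op k l * idn p = cap_op k l"
  "p = k + l \<Longrightarrow> cup_op k l * idn p = cup_op k l"
  "p = Suc (Suc (k + l)) \<Longrightarrow> idn p * cup_op k l = cup_op k l"
  "p = Suc (Suc (k + l)) \<Longrightarrow> cross_op k l * idn p = cross_op k l"
  "p = Suc (Suc (k + l)) \<Longrightarrow> idn p * cross_op k l = cross_op k l"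
  "p = Suc (k + l) \<Longrightarrow> dot_op k l * idn p = dot_op k l"
  "p = Suc (k + l) \<Longrightarrow> idn p * dot_op k l = dot_op k l"
  using idn_ops[OF gen_ser_hom(2), of k l] idn_ops[OF gen_ser_hom(3), of k l]
    idn_ops[OF gen_ser_hom(4), of k l] idn_ops[OF gen_ser_hom(5), of k l]
  by simp_all

lemma cup_cup: "cup_op k (Suc (Suc l)) * cup_op k l = cup_op (Suc (Suc k)) l * cup_op k l"
  by (rule interchange[OF gen_ser_hom(3) gen_ser_hom(3), where p = 0]) simp_all

text \<open>
  This is the relation \<open>cap_slide_ops\<close> turned upside down.  Bend the two outer legs of both sides of that
  relation upwards, by a cup on the left and a cup on the right of the middle strand.  In each case one
  of the cups straightens against the cap, while the other one stays below the crossing.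
\<close>

lemma cup_slide: "cross_op (Suc k) l * cup_op k (Suc l) = cross_op k (Suc l) * cup_op (Suc k) l"
proof -
  let ?C = "cup_op k (Suc (Suc (Suc l))) * cup_op (Suc k) l :: 'a endo fps"
  have cups: "?C = cup_op (Suc (Suc (Suc k))) l * cup_op k (Suc l)"
    by (rule interchange[OF gen_ser_hom(3) gen_ser_hom(3), where p = 1]) simp_all
  have "cap_op (Suc (Suc k)) (Suc l) * cross_op (Suc k) (Suc (Suc l)) * ?C =
      cap_op (Suc (Suc k)) (Suc l) * (cross_op (Suc k) (Suc (Suc l)) * cup_op (Suc (Suc (Suc k))) l) * cup_op k (Suc l)"
    by (simp add: cups mult.assoc)
  also have "cross_op (Suc k) (Suc (Suc l)) * cup_op (Suc (Suc (Suc k))) l = cup_op (Suc (Suc (Suc k))) l * cross_op (Suc k) l"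
    by (rule interchange[OF gen_ser_hom(4) gen_ser_hom(3), where p = 0]) simp_all
  also have "cap_op (Suc (Suc k)) (Suc l) * (cup_op (Suc (Suc (Suc k))) l * cross_op (Suc k) l) * cup_op k (Suc l)
      = cap_op (Suc (Suc k)) (Suc l) * cup_op (Suc (Suc (Suc k))) l * cross_op (Suc k) l * cup_op k (Suc l)"
    by (simp add: mult.assoc)
  also have "\<dots> = cross_op (Suc k) l * cup_op k (Suc l)"
    by (simp add: zigzag_right_ops)
  finally have L: "cap_op (Suc (Suc k)) (Suc l) * cross_op (Suc k) (Suc (Suc l)) * ?C = cross_op (Suc k) l * cup_op k (Suc l)" .
  have "cap_op (Suc k) (Suc (Suc l)) * cross_op (Suc (Suc k)) (Suc l) * ?C =
      cap_op (Suc k) (Suc (Suc l)) * (cross_op (Suc (Suc k)) (Suc l) * cup_op k (Suc (Suc (Suc l)))) * cup_op (Suc k) l"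
    by (simp add: mult.assoc)
  also have "cross_op (Suc (Suc k)) (Suc l) * cup_op k (Suc (Suc (Suc l))) = cup_op k (Suc (Suc (Suc l))) * cross_op k (Suc l)"
    by (rule interchange[OF gen_ser_hom(3) gen_ser_hom(4), where p = 0, symmetric]) simp_all
  also have "cap_op (Suc k) (Suc (Suc l)) * (cup_op k (Suc (Suc (Suc l))) * cross_op k (Suc l)) * cup_op (Suc k) l
      = cap_op (Suc k) (Suc (Suc l)) * cup_op k (Suc (Suc (Suc l))) * cross_op k (Suc l) * cup_op (Suc k) l"
    by (simp add: mult.assoc)
  also have "\<dots> = cross_op k (Suc l) * cup_op (Suc k) l"
    by (simp add: zigzag_left_ops)
  finally show ?thesis
    using L by (simp add: cap_slide_ops)
qed

lemma curl: "cap_op (Suc k) l * (cross_op k (Suc l) * cup_op (Suc k) l) = idn (Suc (k + l))"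
proof -
  have "cap_op (Suc k) l * (cross_op k (Suc l) * cup_op (Suc k) l) = cap_op (Suc k) l * cross_op (Suc k) l * cup_op k (Suc l)"
    by (simp add: mult.assoc flip: cup_slide)
  then show ?thesis
    by (simp add: cap_cross_ops zigzag_left_ops)
qed

text \<open>
  A cup can be recovered from the result of closing one of its legs by a cap.  Closing a leg of
  \<open>s \<circ> cup\<close> gives the curl, which is a straight strand, just as for the cup itself.
\<close>

lemma cross_cup_ops: "cross_op k l * cup_op k l = cup_op k l"
proof -
  have "cross_op k l * cup_op k l = idn (Suc (Suc (k + l))) * (cross_op k l * cup_op k l)"
    by (simp flip: mult.assoc)
  also have "idn (Suc (Suc (k + l))) = cap_op (Suc k) (Suc l) * (cup_op k (Suc (Suc l)) :: 'a endo fps)"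
    by (simp add: zigzag_left_ops)
  also have "\<dots> * (cross_op k l * cup_op k l) = cap_op (Suc k) (Suc l) * (cup_op k (Suc (Suc l)) * cross_op k l) * cup_op k l"
    by (simp add: mult.assoc)
  also have "cup_op k (Suc (Suc l)) * cross_op k l = cross_op (Suc (Suc k)) l * (cup_op k (Suc (Suc l)) :: 'a endo fps)"
    by (rule interchange[OF gen_ser_hom(3) gen_ser_hom(4), where p = 0]) simp_all
  also have "cap_op (Suc k) (Suc l) * (cross_op (Suc (Suc k)) l * cup_op k (Suc (Suc l))) * cup_op k l
      = cap_op (Suc k) (Suc l) * cross_op (Suc (Suc k)) l * (cup_op k (Suc (Suc l)) * cup_op k l)"
    by (simp add: mult.assoc)
  also have "\<dots> = cap_op (Suc (Suc k)) l * (cross_op (Suc k) (Suc l) * cup_op (Suc (Suc k)) l) * cup_op k l"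
    by (simp add: cup_cup mult.assoc flip: cap_slide_ops)
  also have "\<dots> = cup_op k l"
    by (simp add: curl)
  finally show ?thesis .
qed

text \<open>
  Put a zigzag into the right leg of the cup and move the dot over the cap of that zigzag, where
  it changes its sign; it then lies on the left leg of the cup.
\<close>

lemma cup_dot_ops: "dot_op k (Suc l) * cup_op k l = - (dot_op (Suc k) l * cup_op k l)"
proof -
  have "dot_op (Suc k) l * cup_op k l = cap_op (Suc k) (Suc l) * (cup_op (Suc (Suc k)) l * dot_op (Suc k) l) * cup_op k l"
    by (simp add: zigzag_right_ops flip: mult.assoc)
  also have "cup_op (Suc (Suc k)) l * dot_op (Suc k) l = dot_op (Suc k) (Suc (Suc l)) * (cup_op (Suc (Suc k)) l :: 'a endo fps)"
    by (rule interchange[OF gen_ser_hom(5) gen_ser_hom(3), where p = 0, symmetric]) simp_all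
  also have "cap_op (Suc k) (Suc l) * (dot_op (Suc k) (Suc (Suc l)) * cup_op (Suc (Suc k)) l) * cup_op k l
      = (cap_op (Suc k) (Suc l) * dot_op (Suc k) (Suc (Suc l))) * (cup_op (Suc (Suc k)) l * cup_op k l)"
    by (simp add: mult.assoc)
  also have "\<dots> = - (cap_op (Suc k) (Suc l) * (dot_op (Suc (Suc k)) (Suc l) * cup_op k (Suc (Suc l))) * cup_op k l)"
    by (simp add: cap_dot_ops mult.assoc flip: cup_cup)
  also have "dot_op (Suc (Suc k)) (Suc l) * cup_op k (Suc (Suc l)) = cup_op k (Suc (Suc l)) * (dot_op k (Suc l) :: 'a endo fps)"
    by (rule interchange[OF gen_ser_hom(3) gen_ser_hom(5), where p = 0, symmetric]) simp_all
  also have "- (cap_op (Suc k) (Suc l) * (cup_op k (Suc (Suc l)) * dot_op k (Suc l)) * cup_op k l)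
      = - (dot_op k (Suc l) * cup_op k l)"
    by (simp add: zigzag_left_ops flip: mult.assoc)
  finally show ?thesis by simp
qed

text \<open>
  Conjugate \<open>dot_cross_ops\<close> by the crossing, which is absorbed by caps and cups.
\<close>

lemma cross_dot_ops:
  "cross_op k l * dot_op k (Suc l) = dot_op (Suc k) l * cross_op k l + idn (Suc (Suc (k + l))) - cup_op k l * cap_op k l"
proof -
  have "cross_op k l * dot_op k (Suc l) = cross_op k l * (dot_op k (Suc l) * (cross_op k l * cross_op k l))"
    by (simp add: cross_cross_ops)
  also have "\<dots> = cross_op k l * (dot_op k (Suc l) * cross_op k l) * cross_op k l"
    by (simp add: mult.assoc)
  also have "\<dots> = (cross_op k l * cross_op k l) * (dot_op (Suc k) l * cross_op k l) + cross_op k l * cross_op k l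
      - (cross_op k l * cup_op k l) * (cap_op k l * cross_op k l)"
    by (simp add: dot_cross_ops algebra_simps)
  also have "\<dots> = dot_op (Suc k) l * cross_op k l + idn (Suc (Suc (k + l))) - cup_op k l * cap_op k l"
    by (simp add: cross_cross_ops cross_cup_ops cap_cross_ops flip: mult.assoc)
  finally show ?thesis .
qed

section \<open>Geometric series in the dot\<close>

definition geo :: "'k::comm_ring_1 \<Rightarrow> 'k poly fps" where
  "geo \<sigma> = Abs_fps (\<lambda>n. monom (\<sigma> ^ n) n)"

lemma geo_inverse: "geo \<sigma> * (1 - fps_const (monom \<sigma> 1) * fps_X) = 1"
proof (rule fps_ext)
  fix n
  have "geo \<sigma> * (1 - fps_const (monom \<sigma> 1) * fps_X) = geo \<sigma> - (geo \<sigma> * fps_const (monom \<sigma> 1)) * fps_X"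
    by (simp add: algebra_simps)
  then show "fps_nth (geo \<sigma> * (1 - fps_const (monom \<sigma> 1) * fps_X)) n = fps_nth 1 n"
    by (cases n) (auto simp: geo_def mult_monom monom_0 one_pCons mult.commute)
qed

lemma y_fps_eq: "y_fps = fps_X * geo 1"
  by (rule fps_ext) (simp add: y_fps_def geo_def)

lemma w_fps_eq: "w_fps = fps_X * geo (- 1)"
  by (rule fps_ext) (simp add: w_fps_def geo_def)

text \<open>
  The partial fraction decomposition of \<open>2 / (1 - \<tau>\<^sup>2 x\<^sup>2)\<close>.
\<close>

lemma geo_mult_geo_uminus: "2 * (geo \<sigma> * geo (- \<sigma>)) = geo \<sigma> + geo (- \<sigma>)"
proof -
  let ?t = "fps_const (monom \<sigma> 1) * fps_X"
  have plus: "geo \<sigma> * (1 - ?t) = 1" and minus: "geo (- \<sigma>) * (1 + ?t) = 1"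
    using geo_inverse[of \<sigma>] geo_inverse[of "- \<sigma>"]
    by (simp_all add: minus_monom[symmetric] fps_const_neg[symmetric] del: fps_const_neg)
  have "geo \<sigma> + geo (- \<sigma>) = geo \<sigma> * (geo (- \<sigma>) * (1 + ?t)) + geo (- \<sigma>) * (geo \<sigma> * (1 - ?t))"
    by (simp only: plus minus mult_1_right)
  then show ?thesis
    by (simp add: algebra_simps)
qed

text \<open>
  The scalar \<open>\<sigma> / u\<close>.
\<close>

definition tau :: "'k::comm_ring_1 \<Rightarrow> 'k endo fps" where
  "tau \<sigma> = scal (fps_const \<sigma> * fps_X)"

lemma tau_uminus: "tau (- \<sigma>) = - tau \<sigma>"
proof -
  have "fps_const (- \<sigma>) * fps_X = - (fps_const \<sigma> * fps_X :: 'a fps)"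
    by (simp flip: fps_const_neg)
  then show ?thesis
    by (simp only: tau_def scal_uminus)
qed

abbreviation geo_op :: "'k::comm_ring_1 \<Rightarrow> nat \<Rightarrow> nat \<Rightarrow> 'k endo fps" where
  "geo_op \<sigma> k l \<equiv> dots k (geo \<sigma>) l"

lemma dots_linear: "dots k (fps_const (monom \<sigma> 1) * fps_X) l = tau \<sigma> * dot_op k l"
proof (rule fps_ext)
  fix n
  have "act (poly_at_dot (monom \<sigma> 1)) = scalar \<sigma> * act dot"
  proof -
    have "dot \<circ>\<^sub>A ident 1 = (dot :: 'a ab_mor)"
      using comp_laws(3)[of "dot :: 'a ab_mor"] by simp
    then show ?thesis
      by (subst act_poly_at_dot[of _ 1]) (simp_all add: degree_monom_le)
  qed
  then have "poly_at_dot (monom \<sigma> 1) = \<sigma> *\<^sub>A dot"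
    by (intro act_inject[OF poly_at_dot_hom scale_hom[OF generator_hom(5)]]) (simp add: act_scale)
  then show "fps_nth (dots k (fps_const (monom \<sigma> 1) * fps_X) l) n = fps_nth (tau \<sigma> * dot_op k l) n"
    by (auto simp: dots_nth tau_def ops_const poly_at_dot_0 wact_scale)
qed

lemma dots_scal: "dots k F l * scal c = scal c * dots k F l"
  and dots_scal_left: "dots k F l * (scal c * r) = scal c * (dots k F l * r)"
  by (simp_all add: dots_def ops_scal ops_scal_left)

lemma ops_tau: "ops k f l * tau \<sigma> = tau \<sigma> * ops k f l"
  and ops_tau_left: "ops k f l * (tau \<sigma> * r) = tau \<sigma> * (ops k f l * r)"
  and dots_tau: "dots k F l * tau \<sigma> = tau \<sigma> * dots k F l"
  and dots_tau_left: "dots k F l * (tau \<sigma> * r) = tau \<sigma> * (dots k F l * r)"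
  by (simp_all add: tau_def ops_scal ops_scal_left dots_scal dots_scal_left)

lemma tau_scal_left: "tau \<sigma> * (scal c * r) = scal c * (tau \<sigma> * r)"
  by (simp add: tau_def scal_commute flip: mult.assoc)

lemma idn_tau: "idn n * tau \<sigma> = tau \<sigma> * idn n"
  by (simp add: idn_def ops_tau)

lemma dots_idn [simp]:
  "p = Suc (k + l) \<Longrightarrow> idn p * dots k F l = dots k F l"
  "p = Suc (k + l) \<Longrightarrow> dots k F l * idn p = dots k F l"
  using idn_ops[OF at_dot_ser_hom[of F], of k l] by (simp_all add: dots_def)

lemma geo_resolvent:
  "geo_op \<sigma> k l * (idn (Suc (k + l)) - tau \<sigma> * dot_op k l) = idn (Suc (k + l))"
  "(idn (Suc (k + l)) - tau \<sigma> * dot_op k l) * geo_op \<sigma> k l = idn (Suc (k + l))"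
proof -
  have lin: "dots k (1 - fps_const (monom \<sigma> 1) * fps_X) l = idn (Suc (k + l)) - tau \<sigma> * dot_op k l"
    by (simp only: dots_diff dots_one dots_linear) simp
  show 1: "geo_op \<sigma> k l * (idn (Suc (k + l)) - tau \<sigma> * dot_op k l) = idn (Suc (k + l))"
    unfolding lin[symmetric] dots_mult[symmetric] geo_inverse by (simp add: dots_one)
  show "(idn (Suc (k + l)) - tau \<sigma> * dot_op k l) * geo_op \<sigma> k l = idn (Suc (k + l))"
    using 1 unfolding lin[symmetric] by (simp add: dots_commute)
qed

lemma geo_product: "2 * (geo_op \<sigma> k l * geo_op (- \<sigma>) k l) = geo_op \<sigma> k l + geo_op (- \<sigma>) k l"
proof -
  have "2 * (geo_op \<sigma> k l * geo_op (- \<sigma>) k l) = dots k (2 * (geo \<sigma> * geo (- \<sigma>))) l"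
    by (simp only: mult_2 dots_add dots_mult)
  then show ?thesis
    by (simp only: geo_mult_geo_uminus dots_add)
qed

section \<open>Moving geometric series through the generators\<close>

text \<open>
  If \<open>s\<close> intertwines \<open>Y\<close> and \<open>X\<close> up to \<open>c\<close>, then it intertwines their resolvents \<open>B\<close> and \<open>A\<close> up to
  \<open>A c B\<close>: multiply \<open>(i - X) s + c = s (i - Y)\<close> by \<open>A\<close> on the left and by \<open>B\<close> on the right.
\<close>

lemma resolvent_exchange:
  fixes s :: "'a::ring_1"
  assumes "A * (i - X) = i" "(i - Y) * B = i" "X * s = s * Y + c" "i * s = s" "s * i = s" "A * i = A"
  shows "s * B = A * s - A * c * B"
proof -
  have "A * s = A * (s * ((i - Y) * B))"
    by (simp add: assms)
  also have "\<dots> = A * (s - s * Y) * B"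
    by (simp add: right_diff_distrib assms(5) flip: mult.assoc)
  also have "s - s * Y = (i - X) * s + c"
    using assms(3,4) by (simp add: algebra_simps)
  also have "A * \<dots> * B = A * (i - X) * s * B + A * c * B"
    by (simp add: distrib_left distrib_right mult.assoc)
  also have "\<dots> = s * B + A * c * B"
    by (simp add: assms)
  finally show ?thesis by simp
qed

text \<open>
  The inverse \<open>B\<close> of \<open>i + Y\<close> may be inserted next to \<open>c\<close>, where \<open>i + Y\<close> acts as \<open>i - X\<close> and then cancels
  against its inverse \<open>A\<close>.  The first version serves for caps, the second one for cups.
\<close>

lemma resolvent_transpose:
  fixes c :: "'a::ring_1"
  assumes "(i - X) * A = i" "(i + Y) * B = i" "c * X = - (c * Y)" "c * i = c" "i * A = A" "i * B = B"
    and "A * B = B * A"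
  shows "c * A = c * B"
proof -
  have "c * A = c * ((i + Y) * B) * A"
    by (simp add: assms)
  also have "\<dots> = (c * (i + Y)) * (A * B)"
    by (simp add: mult.assoc assms(7))
  also have "c * (i + Y) = c * (i - X)"
    by (simp add: distrib_left right_diff_distrib assms)
  also have "\<dots> * (A * B) = c * ((i - X) * A) * B"
    by (simp add: mult.assoc)
  also have "\<dots> = c * B"
    by (simp add: assms mult.assoc)
  finally show ?thesis .
qed

lemma resolvent_transpose_left:
  fixes c :: "'a::ring_1"
  assumes "A * (i - X) = i" "B * (i + Y) = i" "X * c = - (Y * c)" "i * c = c" "A * i = A" "B * i = B"
    and "A * B = B * A"
  shows "A * c = B * c"
proof -
  have "A * c = A * (B * (i + Y)) * c"
    by (simp add: assms)
  also have "\<dots> = (B * A) * ((i + Y) * c)"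
    by (simp add: mult.assoc flip: assms(7))
  also have "(i + Y) * c = (i - X) * c"
    by (simp add: distrib_right left_diff_distrib assms)
  also have "B * A * \<dots> = B * (A * (i - X)) * c"
    by (simp add: mult.assoc)
  also have "\<dots> = B * c"
    by (simp add: assms)
  finally show ?thesis .
qed

lemma dots_dots_commute: "dots k F (Suc l) * dots (Suc k) G l = dots (Suc k) G l * dots k F (Suc l)"
  unfolding dots_def by (rule interchange[OF at_dot_ser_hom at_dot_ser_hom, where p = 0]) simp_all

lemma cap_geo: "cap_op k l * geo_op \<sigma> k (Suc l) = cap_op k l * geo_op (- \<sigma>) (Suc k) l"
proof (rule resolvent_transpose)
  show "(idn (Suc (Suc (k + l))) - tau \<sigma> * dot_op k (Suc l)) * geo_op \<sigma> k (Suc l) = idn (Suc (Suc (k + l)))"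
    using geo_resolvent(2)[where k = k and l = "Suc l"] by simp
  show "(idn (Suc (Suc (k + l))) + tau \<sigma> * dot_op (Suc k) l) * geo_op (- \<sigma>) (Suc k) l = idn (Suc (Suc (k + l)))"
    using geo_resolvent(2)[where k = "Suc k" and l = l and \<sigma> = "- \<sigma>"] by (simp add: tau_uminus)
  show "cap_op k l * (tau \<sigma> * dot_op k (Suc l)) = - (cap_op k l * (tau \<sigma> * dot_op (Suc k) l))"
    by (simp add: ops_tau_left cap_dot_ops)
qed (simp_all add: dots_dots_commute)

lemma geo_cup: "geo_op \<sigma> k (Suc l) * cup_op k l = geo_op (- \<sigma>) (Suc k) l * cup_op k l"
proof (rule resolvent_transpose_left)
  show "geo_op \<sigma> k (Suc l) * (idn (Suc (Suc (k + l))) - tau \<sigma> * dot_op k (Suc l)) = idn (Suc (Suc (k + l)))"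
    using geo_resolvent(1)[where k = k and l = "Suc l"] by simp
  show "geo_op (- \<sigma>) (Suc k) l * (idn (Suc (Suc (k + l))) + tau \<sigma> * dot_op (Suc k) l) = idn (Suc (Suc (k + l)))"
    using geo_resolvent(1)[where k = "Suc k" and l = l and \<sigma> = "- \<sigma>"] by (simp add: tau_uminus)
  show "tau \<sigma> * dot_op k (Suc l) * cup_op k l = - (tau \<sigma> * dot_op (Suc k) l * cup_op k l)"
    by (simp add: cup_dot_ops mult.assoc)
qed (simp_all add: dots_dots_commute)

lemma cross_geo_right:
  "cross_op k l * geo_op \<sigma> (Suc k) l = geo_op \<sigma> k (Suc l) * cross_op k l
    - tau \<sigma> * (geo_op \<sigma> k (Suc l) * (idn (Suc (Suc (k + l))) - cup_op k l * cap_op k l) * geo_op \<sigma> (Suc k) l)"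
proof -
  have "cross_op k l * geo_op \<sigma> (Suc k) l = geo_op \<sigma> k (Suc l) * cross_op k l
      - geo_op \<sigma> k (Suc l) * (tau \<sigma> * (idn (Suc (Suc (k + l))) - cup_op k l * cap_op k l)) * geo_op \<sigma> (Suc k) l"
  proof (rule resolvent_exchange)
    show "geo_op \<sigma> k (Suc l) * (idn (Suc (Suc (k + l))) - tau \<sigma> * dot_op k (Suc l)) = idn (Suc (Suc (k + l)))"
      using geo_resolvent(1)[where k = k and l = "Suc l"] by simp
    show "(idn (Suc (Suc (k + l))) - tau \<sigma> * dot_op (Suc k) l) * geo_op \<sigma> (Suc k) l = idn (Suc (Suc (k + l)))"
      using geo_resolvent(2)[where k = "Suc k" and l = l] by simp
    show "tau \<sigma> * dot_op k (Suc l) * cross_op k l = cross_op k l * (tau \<sigma> * dot_op (Suc k) l)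
        + tau \<sigma> * (idn (Suc (Suc (k + l))) - cup_op k l * cap_op k l)"
      by (simp add: mult.assoc dot_cross_ops ops_tau_left algebra_simps)
  qed simp_all
  then show ?thesis
    by (simp add: dots_tau_left mult.assoc)
qed

lemma cross_geo_left:
  "cross_op k l * geo_op \<sigma> k (Suc l) = geo_op \<sigma> (Suc k) l * cross_op k l
    + tau \<sigma> * (geo_op \<sigma> (Suc k) l * (idn (Suc (Suc (k + l))) - cup_op k l * cap_op k l) * geo_op \<sigma> k (Suc l))"
proof -
  have "cross_op k l * geo_op \<sigma> k (Suc l) = geo_op \<sigma> (Suc k) l * cross_op k l
      - geo_op \<sigma> (Suc k) l * (- (tau \<sigma> * (idn (Suc (Suc (k + l))) - cup_op k l * cap_op k l))) * geo_op \<sigma> k (Suc l)"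
  proof (rule resolvent_exchange)
    show "geo_op \<sigma> (Suc k) l * (idn (Suc (Suc (k + l))) - tau \<sigma> * dot_op (Suc k) l) = idn (Suc (Suc (k + l)))"
      using geo_resolvent(1)[where k = "Suc k" and l = l] by simp
    show "(idn (Suc (Suc (k + l))) - tau \<sigma> * dot_op k (Suc l)) * geo_op \<sigma> k (Suc l) = idn (Suc (Suc (k + l)))"
      using geo_resolvent(2)[where k = k and l = "Suc l"] by simp
    show "tau \<sigma> * dot_op (Suc k) l * cross_op k l = cross_op k l * (tau \<sigma> * dot_op k (Suc l))
        + - (tau \<sigma> * (idn (Suc (Suc (k + l))) - cup_op k l * cap_op k l))"
      by (simp add: mult.assoc cross_dot_ops ops_tau_left algebra_simps)
  qed simp_all
  then show ?thesis
    by (simp add: dots_tau_left mult.assoc)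
qed

lemma cap_dots:
  "cap_op (Suc k) l * dots k F (Suc (Suc l)) = dots k F l * cap_op (Suc k) l"
  "cap_op k (Suc l) * dots (Suc (Suc k)) F l = dots k F l * cap_op k (Suc l)"
  unfolding dots_def
  by (rule interchange[OF at_dot_ser_hom gen_ser_hom(2), where p = 0, symmetric]; simp)
    (rule interchange[OF gen_ser_hom(2) at_dot_ser_hom, where p = 0]; simp)

lemma cup_dots:
  "dots k F (Suc (Suc l)) * cup_op (Suc k) l = cup_op (Suc k) l * dots k F l"
  "dots (Suc (Suc k)) F l * cup_op k (Suc l) = cup_op k (Suc l) * dots k F l"
  unfolding dots_def
  by (rule interchange[OF at_dot_ser_hom gen_ser_hom(3), where p = 0]; simp)
    (rule interchange[OF gen_ser_hom(3) at_dot_ser_hom, where p = 0, symmetric]; simp)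

lemma cross_dots:
  "cross_op (Suc k) l * dots k F (Suc (Suc l)) = dots k F (Suc (Suc l)) * cross_op (Suc k) l"
  "cross_op k (Suc l) * dots (Suc (Suc k)) F l = dots (Suc (Suc k)) F l * cross_op k (Suc l)"
  unfolding dots_def
  by (rule interchange[OF at_dot_ser_hom gen_ser_hom(4), where p = 0, symmetric]; simp)
    (rule interchange[OF gen_ser_hom(4) at_dot_ser_hom, where p = 0]; simp)

section \<open>Bubbles\<close>

definition bubble :: "'k::comm_ring_1 \<Rightarrow> nat \<Rightarrow> nat \<Rightarrow> 'k endo fps" where
  "bubble \<sigma> k l = cap_op k l * geo_op \<sigma> (Suc k) l * cup_op k l"

text \<open>
  The dots of a loop may be moved from one of its arcs to the other through the cap, at the cost of the
  sign of \<open>\<sigma>\<close>.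
\<close>

lemma loop_left: "cap_op k l * (geo_op \<sigma> k (Suc l) * cup_op k l) = bubble (- \<sigma>) k l"
  by (simp add: bubble_def cap_geo flip: mult.assoc)

lemma mirror_curl: "cap_op k (Suc l) * (cross_op (Suc k) l * cup_op k (Suc l)) = idn (Suc (k + l))"
proof -
  have "cap_op k (Suc l) * (cross_op (Suc k) l * cup_op k (Suc l)) = cap_op (Suc k) l * cross_op k (Suc l) * cup_op k (Suc l)"
    by (simp add: cap_slide_ops mult.assoc)
  then show ?thesis
    by (simp add: mult.assoc cross_cup_ops zigzag_left_ops)
qed

text \<open>
  Move the dots through the cup onto the strand that enters the crossing on the right, and apply
  \<open>cross_geo_right\<close>.  Its three terms contain a curl without dots, a loop to the right of the strand
  and, where \<open>e\<close> was inserted, a strand that can be straightened.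
\<close>

lemma curl_right:
  "cap_op (Suc k) l * (cross_op k (Suc l) * geo_op \<sigma> (Suc (Suc k)) l) * cup_op (Suc k) l =
    geo_op (- \<sigma>) k l + tau \<sigma> * (geo_op (- \<sigma>) k l * bubble \<sigma> (Suc k) l) - tau \<sigma> * (geo_op (- \<sigma>) k l * geo_op \<sigma> k l)"
proof -
  let ?i = "idn (Suc (Suc (Suc (k + l)))) :: 'a endo fps"
  let ?A = "geo_op (- \<sigma>) k (Suc (Suc l))" and ?B = "geo_op (- \<sigma>) (Suc k) (Suc l)"
  have "cap_op (Suc k) l * (cross_op k (Suc l) * geo_op \<sigma> (Suc (Suc k)) l) * cup_op (Suc k) l
      = cap_op (Suc k) l * (cross_op k (Suc l) * ?B) * cup_op (Suc k) l"
    using geo_cup[where \<sigma> = "- \<sigma>" and k = "Suc k" and l = l] by (simp add: mult.assoc)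
  also have "cross_op k (Suc l) * ?B = ?A * cross_op k (Suc l)
      + tau \<sigma> * (?A * (?i - cup_op k (Suc l) * cap_op k (Suc l)) * ?B)"
    by (subst cross_geo_right) (simp add: tau_uminus)
  also have "cap_op (Suc k) l * \<dots> * cup_op (Suc k) l
      = (cap_op (Suc k) l * ?A) * (cross_op k (Suc l) * cup_op (Suc k) l)
        + tau \<sigma> * ((cap_op (Suc k) l * ?A) * (?B * cup_op (Suc k) l))
        - tau \<sigma> * ((cap_op (Suc k) l * ?A) * cup_op k (Suc l) * ((cap_op k (Suc l) * ?B) * cup_op (Suc k) l))"
    by (simp add: algebra_simps ops_tau_left)
  also have "cap_op (Suc k) l * ?A = geo_op (- \<sigma>) k l * cap_op (Suc k) l"
    by (rule cap_dots)
  also have "cap_op k (Suc l) * ?B = cap_op k (Suc l) * geo_op \<sigma> k (Suc (Suc l))"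
    by (simp add: cap_geo)
  also have "cap_op k (Suc l) * geo_op \<sigma> k (Suc (Suc l)) * cup_op (Suc k) l = geo_op \<sigma> k l"
    by (simp add: mult.assoc cup_dots) (simp add: zigzag_right_ops flip: mult.assoc)
  also have "geo_op (- \<sigma>) k l * cap_op (Suc k) l * (cross_op k (Suc l) * cup_op (Suc k) l) = geo_op (- \<sigma>) k l"
    by (simp add: mult.assoc curl)
  also have "geo_op (- \<sigma>) k l * cap_op (Suc k) l * (?B * cup_op (Suc k) l) = geo_op (- \<sigma>) k l * bubble \<sigma> (Suc k) l"
    using loop_left[where \<sigma> = "- \<sigma>" and k = "Suc k" and l = l] by (simp add: mult.assoc)
  also have "geo_op (- \<sigma>) k l * cap_op (Suc k) l * cup_op k (Suc l) = geo_op (- \<sigma>) k l"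
    by (simp add: mult.assoc zigzag_left_ops)
  finally show ?thesis .
qed

text \<open>
  The mirror image of the preceding argument, with \<open>cross_geo_left\<close>.
\<close>

lemma curl_left:
  "cap_op k (Suc l) * (geo_op \<sigma> k (Suc (Suc l)) * cross_op (Suc k) l) * cup_op k (Suc l) =
    geo_op (- \<sigma>) k l - tau \<sigma> * (geo_op (- \<sigma>) k l * bubble (- \<sigma>) k (Suc l)) + tau \<sigma> * (geo_op (- \<sigma>) k l * geo_op \<sigma> k l)"
proof -
  let ?i = "idn (Suc (Suc (Suc (k + l)))) :: 'a endo fps"
  let ?A = "geo_op (- \<sigma>) (Suc (Suc k)) l" and ?B = "geo_op (- \<sigma>) (Suc k) (Suc l)"
  have "cap_op k (Suc l) * (geo_op \<sigma> k (Suc (Suc l)) * cross_op (Suc k) l) * cup_op k (Suc l)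
      = cap_op k (Suc l) * (cross_op (Suc k) l * ?B) * cup_op k (Suc l)"
    by (simp add: mult.assoc geo_cup flip: cross_dots) 
  also have "cross_op (Suc k) l * ?B = ?A * cross_op (Suc k) l
      - tau \<sigma> * (?A * (?i - cup_op (Suc k) l * cap_op (Suc k) l) * ?B)"
    by (subst cross_geo_left) (simp add: tau_uminus)
  also have "cap_op k (Suc l) * \<dots> * cup_op k (Suc l)
      = (cap_op k (Suc l) * ?A) * (cross_op (Suc k) l * cup_op k (Suc l))
        - tau \<sigma> * ((cap_op k (Suc l) * ?A) * (?B * cup_op k (Suc l)))
        + tau \<sigma> * ((cap_op k (Suc l) * ?A) * cup_op (Suc k) l * ((cap_op (Suc k) l * ?B) * cup_op k (Suc l)))"
    by (simp add: algebra_simps ops_tau_left)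
  also have "cap_op k (Suc l) * ?A = geo_op (- \<sigma>) k l * cap_op k (Suc l)"
    by (rule cap_dots)
  also have "cap_op (Suc k) l * ?B = cap_op (Suc k) l * geo_op \<sigma> (Suc (Suc k)) l"
    by (simp add: cap_geo)
  also have "cap_op (Suc k) l * geo_op \<sigma> (Suc (Suc k)) l * cup_op k (Suc l) = geo_op \<sigma> k l"
    by (simp add: mult.assoc cup_dots) (simp add: zigzag_left_ops flip: mult.assoc)
  also have "geo_op (- \<sigma>) k l * cap_op k (Suc l) * (cross_op (Suc k) l * cup_op k (Suc l)) = geo_op (- \<sigma>) k l"
    by (simp add: mult.assoc mirror_curl)
  also have "geo_op (- \<sigma>) k l * cap_op k (Suc l) * (?B * cup_op k (Suc l)) = geo_op (- \<sigma>) k l * bubble (- \<sigma>) k (Suc l)"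
    by (simp add: mult.assoc bubble_def)
  also have "geo_op (- \<sigma>) k l * cap_op k (Suc l) * cup_op (Suc k) l = geo_op (- \<sigma>) k l"
    by (simp add: mult.assoc zigzag_right_ops)
  finally show ?thesis .
qed

text \<open>
  Close \<open>cross_geo_right\<close> by a cap and a cup, which absorb the crossing.  The term with \<open>e\<close> splits into
  two loops; the one without \<open>e\<close> has series on both arcs, and these combine by \<open>geo_product\<close>.
\<close>

lemma bubble_quadratic:
  "2 * bubble \<sigma> k l = 2 * bubble (- \<sigma>) k l - tau \<sigma> * (bubble \<sigma> k l + bubble (- \<sigma>) k l)
    + 2 * (tau \<sigma> * (bubble (- \<sigma>) k l * bubble \<sigma> k l))"
proof -
  have "bubble \<sigma> k l = cap_op k l * (cross_op k l * geo_op \<sigma> (Suc k) l) * cup_op k l"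
    by (simp add: bubble_def cap_cross_ops flip: mult.assoc)
  also have "\<dots> = cap_op k l * (geo_op \<sigma> k (Suc l) * (cross_op k l * cup_op k l))
      - tau \<sigma> * ((cap_op k l * geo_op \<sigma> k (Suc l)) * geo_op \<sigma> (Suc k) l * cup_op k l)
      + tau \<sigma> * ((cap_op k l * geo_op \<sigma> k (Suc l) * cup_op k l) * (cap_op k l * geo_op \<sigma> (Suc k) l * cup_op k l))"
    by (subst cross_geo_right) (simp add: algebra_simps ops_tau_left)
  also have "cap_op k l * (geo_op \<sigma> k (Suc l) * (cross_op k l * cup_op k l)) = bubble (- \<sigma>) k l"
    by (simp add: cross_cup_ops loop_left)
  also have "cap_op k l * geo_op \<sigma> k (Suc l) * cup_op k l = bubble (- \<sigma>) k l"
    by (simp add: loop_left mult.assoc)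
  also have "cap_op k l * geo_op \<sigma> (Suc k) l * cup_op k l = bubble \<sigma> k l"
    by (simp add: bubble_def)
  also have "(cap_op k l * geo_op \<sigma> k (Suc l)) * geo_op \<sigma> (Suc k) l * cup_op k l
      = cap_op k l * (geo_op \<sigma> (Suc k) l * geo_op (- \<sigma>) (Suc k) l) * cup_op k l"
    by (simp add: cap_geo mult.assoc dots_commute[of _ "geo \<sigma>"])
  finally have *: "bubble \<sigma> k l = bubble (- \<sigma>) k l
      - tau \<sigma> * (cap_op k l * (geo_op \<sigma> (Suc k) l * geo_op (- \<sigma>) (Suc k) l) * cup_op k l)
      + tau \<sigma> * (bubble (- \<sigma>) k l * bubble \<sigma> k l)" .
  have "2 * (cap_op k l * (geo_op \<sigma> (Suc k) l * geo_op (- \<sigma>) (Suc k) l) * cup_op k l)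
      = cap_op k l * (2 * (geo_op \<sigma> (Suc k) l * geo_op (- \<sigma>) (Suc k) l)) * cup_op k l"
    by (simp only: mult_2 distrib_left distrib_right)
  also have "\<dots> = bubble \<sigma> k l + bubble (- \<sigma>) k l"
    by (simp only: geo_product distrib_left distrib_right) (simp add: bubble_def)
  finally have "2 * (tau \<sigma> * (cap_op k l * (geo_op \<sigma> (Suc k) l * geo_op (- \<sigma>) (Suc k) l) * cup_op k l))
      = tau \<sigma> * (bubble \<sigma> k l + bubble (- \<sigma>) k l)"
    by (simp only: mult_2 flip: distrib_left)
  then show ?thesis
    using arg_cong[OF *, of "\<lambda>r. 2 * r"] by (simp only: right_diff_distrib distrib_left)
qed

text \<open>
  Insert the square of the crossing where a loop on the right meets the strand.  By the slide relations the
  cap and the cup then lie to the left of the strand, and only the arc with the dots reaches across it.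
  Moving the dots back through one of the crossings leaves a loop on the left; the two correction terms are
  curls decorated by a series on the straight strand.
\<close>

lemma bubble_slide:
  "bubble \<sigma> (Suc k) l = bubble \<sigma> k (Suc l)
    - tau \<sigma> * (geo_op \<sigma> k l * (cap_op k (Suc l) * (geo_op (- \<sigma>) k (Suc (Suc l)) * cross_op (Suc k) l) * cup_op k (Suc l)))
    + tau \<sigma> * (geo_op (- \<sigma>) k l * (cap_op (Suc k) l * (cross_op k (Suc l) * geo_op \<sigma> (Suc (Suc k)) l) * cup_op (Suc k) l))"
proof -
  let ?i = "idn (Suc (Suc (Suc (k + l)))) :: 'a endo fps"
  let ?F = "geo_op \<sigma> (Suc k) (Suc l)" and ?G = "geo_op \<sigma> (Suc (Suc k)) l"
  let ?X = "cross_op k (Suc l)" and ?Y = "cross_op (Suc k) l"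
  have "bubble \<sigma> (Suc k) l = cap_op (Suc k) l * (?X * ?X * ?G) * cup_op (Suc k) l"
    by (simp add: bubble_def cross_cross_ops mult.assoc)
  also have "\<dots> = (cap_op (Suc k) l * ?X) * (?X * ?G) * cup_op (Suc k) l"
    by (simp add: mult.assoc)
  also have "?X * ?G = ?G * ?X"
    by (rule cross_dots)
  also have "cap_op (Suc k) l * ?X * (?G * ?X) * cup_op (Suc k) l = cap_op k (Suc l) * (?Y * ?G) * (?Y * cup_op k (Suc l))"
    by (simp add: cap_slide_ops mult.assoc cup_slide)
  also have "?Y * ?G = ?F * ?Y - tau \<sigma> * (?F * (?i - cup_op (Suc k) l * cap_op (Suc k) l) * ?G)"
    by (subst cross_geo_right) simp
  also have "cap_op k (Suc l) * \<dots> * (?Y * cup_op k (Suc l))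
      = cap_op k (Suc l) * ?F * ((?Y * ?Y) * cup_op k (Suc l))
        - tau \<sigma> * (cap_op k (Suc l) * (?F * ?G) * (?Y * cup_op k (Suc l)))
        + tau \<sigma> * ((cap_op k (Suc l) * (?F * cup_op (Suc k) l)) * (cap_op (Suc k) l * ?G * (?Y * cup_op k (Suc l))))"
    by (simp add: algebra_simps ops_tau_left)
  also have "?Y * ?Y = ?i"
    by (simp add: cross_cross_ops)
  also have "cap_op k (Suc l) * ?F * (?i * cup_op k (Suc l)) = bubble \<sigma> k (Suc l)"
    by (simp add: bubble_def)
  also have "cap_op k (Suc l) * (?F * ?G) = geo_op \<sigma> k l * (cap_op k (Suc l) * geo_op (- \<sigma>) k (Suc (Suc l)))"
  proof -
    have "cap_op k (Suc l) * (?F * ?G) = (cap_op k (Suc l) * ?G) * ?F"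
      by (simp add: dots_dots_commute mult.assoc)
    also have "\<dots> = geo_op \<sigma> k l * (cap_op k (Suc l) * ?F)"
      by (simp add: cap_dots mult.assoc)
    finally show ?thesis
      by (simp add: cap_geo)
  qed
  also have "?F * cup_op (Suc k) l = geo_op (- \<sigma>) (Suc (Suc k)) l * cup_op (Suc k) l"
    by (rule geo_cup)
  also have "cap_op k (Suc l) * (geo_op (- \<sigma>) (Suc (Suc k)) l * cup_op (Suc k) l) = geo_op (- \<sigma>) k l"
    by (simp add: cap_dots zigzag_right_ops mult.assoc flip: mult.assoc[of "cap_op k (Suc l)"])
  also have "cap_op (Suc k) l * ?G * (?Y * cup_op k (Suc l))
      = cap_op (Suc k) l * (?X * ?G) * cup_op (Suc k) l"
    by (simp add: cup_slide cross_dots mult.assoc)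
  finally show ?thesis
    by (simp add: mult.assoc)
qed

section \<open>Generating functions of bubbles\<close>

text \<open>
  The loop series without denominators: \<open>2 - \<tau>\<close> times \<open>\<beta>\<^sub>r\<close> if \<open>\<sigma> = 1\<close>, and \<open>2 - \<tau>\<close> times \<open>-\<beta>\<^sub>l\<close> if
  \<open>\<sigma> = -1\<close>.  It postpones the division by two to the last step.
\<close>

definition beta_num :: "'k::comm_ring_1 \<Rightarrow> nat \<Rightarrow> nat \<Rightarrow> 'k endo fps" where
  "beta_num \<sigma> k l = (2 - tau \<sigma>) * idn (k + l) + 2 * (tau \<sigma> * bubble \<sigma> k l)"

lemma bubble_dots:
  "bubble \<sigma> (Suc k) l * dots k F l = dots k F l * bubble \<sigma> (Suc k) l"
  "bubble \<sigma> k (Suc l) * dots k F l = dots k F l * bubble \<sigma> k (Suc l)"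
proof -
  have "geo_op \<sigma> (Suc (Suc k)) l * dots k F (Suc (Suc l)) = dots k F (Suc (Suc l)) * geo_op \<sigma> (Suc (Suc k)) l"
    unfolding dots_def by (rule interchange[OF at_dot_ser_hom at_dot_ser_hom, where p = 1, symmetric]) simp_all
  then have "bubble \<sigma> (Suc k) l * dots k F l
      = cap_op (Suc k) l * (dots k F (Suc (Suc l)) * geo_op \<sigma> (Suc (Suc k)) l) * cup_op (Suc k) l"
    by (simp add: bubble_def mult.assoc flip: cup_dots) (simp flip: mult.assoc)
  then show "bubble \<sigma> (Suc k) l * dots k F l = dots k F l * bubble \<sigma> (Suc k) l"
    by (simp add: bubble_def cap_dots flip: mult.assoc)
  have "geo_op \<sigma> (Suc k) (Suc l) * dots (Suc (Suc k)) F l = dots (Suc (Suc k)) F l * geo_op \<sigma> (Suc k) (Suc l)"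
    by (rule dots_dots_commute)
  then have "bubble \<sigma> k (Suc l) * dots k F l
      = cap_op k (Suc l) * (dots (Suc (Suc k)) F l * geo_op \<sigma> (Suc k) (Suc l)) * cup_op k (Suc l)"
    by (simp add: bubble_def mult.assoc flip: cup_dots) (simp flip: mult.assoc)
  then show "bubble \<sigma> k (Suc l) * dots k F l = dots k F l * bubble \<sigma> k (Suc l)"
    by (simp add: bubble_def cap_dots flip: mult.assoc)
qed

lemma beta_num_dots:
  "beta_num \<sigma> (Suc k) l * dots k F l = dots k F l * beta_num \<sigma> (Suc k) l"
  "beta_num \<sigma> k (Suc l) * dots k F l = dots k F l * beta_num \<sigma> k (Suc l)"
  by (simp_all add: beta_num_def mult_2 algebra_simps dots_tau_left dots_tau bubble_dots)

lemma idn_bubble [simp]: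
  "p = k + l \<Longrightarrow> idn p * bubble \<sigma> k l = bubble \<sigma> k l"
  "p = k + l \<Longrightarrow> bubble \<sigma> k l * idn p = bubble \<sigma> k l"
  by (simp_all add: bubble_def mult.assoc) (simp_all flip: mult.assoc)

lemma idn_idn [simp]: "idn n * idn n = idn n"
  using idn_ops(1)[OF gen_ser_hom(1), of 0 n 0] by (simp add: ops_ident)

lemma curl_right_beta_num:
  "2 * (cap_op (Suc k) l * (cross_op k (Suc l) * geo_op \<sigma> (Suc (Suc k)) l) * cup_op (Suc k) l) =
    beta_num \<sigma> (Suc k) l * geo_op (- \<sigma>) k l - tau \<sigma> * geo_op \<sigma> k l"
proof -
  have "2 * (tau \<sigma> * (geo_op (- \<sigma>) k l * geo_op \<sigma> k l)) = tau \<sigma> * (geo_op \<sigma> k l + geo_op (- \<sigma>) k l)"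
    using geo_product[where \<sigma> = \<sigma> and k = k and l = l] by (simp add: mult_2 dots_commute flip: distrib_left)
  then show ?thesis
    unfolding curl_right
    by (simp add: beta_num_dots) (simp add: beta_num_def mult_2 algebra_simps dots_tau dots_tau_left)
qed

lemma curl_left_beta_num:
  "2 * (cap_op k (Suc l) * (geo_op \<sigma> k (Suc (Suc l)) * cross_op (Suc k) l) * cup_op k (Suc l)) =
    beta_num (- \<sigma>) k (Suc l) * geo_op (- \<sigma>) k l + tau \<sigma> * geo_op \<sigma> k l"
proof -
  have "2 * (tau \<sigma> * (geo_op (- \<sigma>) k l * geo_op \<sigma> k l)) = tau \<sigma> * (geo_op \<sigma> k l + geo_op (- \<sigma>) k l)"
    using geo_product[where \<sigma> = \<sigma> and k = k and l = l] by (simp add: mult_2 dots_commute flip: distrib_left)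
  then show ?thesis
    unfolding curl_left
    by (simp add: beta_num_dots) (simp add: beta_num_def mult_2 algebra_simps dots_tau dots_tau_left tau_uminus)
qed

lemma bubble_tau: "bubble \<sigma> k l * tau \<rho> = tau \<rho> * bubble \<sigma> k l"
  and bubble_tau_left: "bubble \<sigma> k l * (tau \<rho> * r) = tau \<rho> * (bubble \<sigma> k l * r)"
  by (simp_all add: bubble_def mult.assoc ops_tau ops_tau_left dots_tau_left)

lemma idn_tau_left: "idn n * (tau \<sigma> * r) = tau \<sigma> * (idn n * r)"
  by (simp add: idn_tau flip: mult.assoc)

lemma beta_num_inverse:
  "beta_num (- \<sigma>) k l * beta_num \<sigma> k l = (2 - tau \<sigma>) * ((2 + tau \<sigma>) * idn (k + l))"
proof -
  let ?b = "bubble \<sigma> k l" and ?c = "bubble (- \<sigma>) k l" and ?t = "tau \<sigma>"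
  have "2 * ?b - 2 * ?c + ?t * (?b + ?c) - 2 * (?t * (?c * ?b)) = 0"
    by (subst bubble_quadratic) simp
  then have "2 * (?t * (2 * ?b - 2 * ?c + ?t * (?b + ?c) - 2 * (?t * (?c * ?b)))) = 0"
    by (simp only: mult_zero_right)
  moreover have "beta_num (- \<sigma>) k l * beta_num \<sigma> k l - (2 - ?t) * ((2 + ?t) * idn (k + l))
      = 2 * (?t * (2 * ?b - 2 * ?c + ?t * (?b + ?c) - 2 * (?t * (?c * ?b))))"
    by (simp add: beta_num_def tau_uminus mult_2 mult_2_right algebra_simps
        bubble_tau bubble_tau_left idn_tau idn_tau_left)
  ultimately show ?thesis by simp
qed

text \<open>
  Insert the curl formulas into \<open>bubble_slide\<close>.  The products \<open>G(\<sigma>) G(-\<sigma>)\<close> occur twice, with opposite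
  signs, so that only the squares remain.
\<close>

lemma beta_num_slide:
  "beta_num \<sigma> (Suc k) l * (idn (Suc (k + l)) - (tau \<sigma> * geo_op (- \<sigma>) k l)\<^sup>2) =
    beta_num \<sigma> k (Suc l) * (idn (Suc (k + l)) - (tau \<sigma> * geo_op \<sigma> k l)\<^sup>2)"
proof -
  let ?G = "geo_op \<sigma> k l" and ?H = "geo_op (- \<sigma>) k l" and ?t = "tau \<sigma>"
  let ?r = "beta_num \<sigma> (Suc k) l" and ?l = "beta_num \<sigma> k (Suc l)"
  have "2 * bubble \<sigma> (Suc k) l = 2 * bubble \<sigma> k (Suc l)
      - ?t * (?G * (2 * (cap_op k (Suc l) * (geo_op (- \<sigma>) k (Suc (Suc l)) * cross_op (Suc k) l) * cup_op k (Suc l))))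
      + ?t * (?H * (2 * (cap_op (Suc k) l * (cross_op k (Suc l) * geo_op \<sigma> (Suc (Suc k)) l) * cup_op (Suc k) l)))"
    by (subst bubble_slide) (simp only: mult_2 algebra_simps)
  also have "\<dots> = 2 * bubble \<sigma> k (Suc l) - ?t * (?G * (?l * ?G - ?t * ?H)) + ?t * (?H * (?r * ?H - ?t * ?G))"
    by (simp only: curl_right_beta_num curl_left_beta_num minus_minus tau_uminus) (simp only: mult_minus_left diff_conv_add_uminus)
  also have "\<dots> = 2 * bubble \<sigma> k (Suc l) - ?t * (?l * (?G * ?G)) + ?t * (?r * (?H * ?H))"
  proof -
    have "?G * (?l * ?G) = ?l * (?G * ?G)" "?H * (?r * ?H) = ?r * (?H * ?H)"
      by (simp_all flip: mult.assoc beta_num_dots)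
    moreover have "?H * ?G = ?G * ?H"
      by (rule dots_commute)
    ultimately show ?thesis
      by (simp add: right_diff_distrib dots_tau_left)
  qed
  finally have d1: "?t * (2 * bubble \<sigma> (Suc k) l) - ?t * (2 * bubble \<sigma> k (Suc l))
      = ?t * (?t * (?r * (?H * ?H))) - ?t * (?t * (?l * (?G * ?G)))"
    by (simp add: distrib_left right_diff_distrib)
  have tau: "beta_num \<sigma> i j * (?t * a) = ?t * (beta_num \<sigma> i j * a)" for i j and a :: "'a endo fps"
    by (simp add: beta_num_def mult_2 algebra_simps bubble_tau_left idn_tau_left)
  have d2: "?r - ?l = ?t * (2 * bubble \<sigma> (Suc k) l) - ?t * (2 * bubble \<sigma> k (Suc l))"
    by (simp add: beta_num_def mult_2 algebra_simps)
  from trans[OF d2 d1] have "?r - ?t * (?t * (?r * (?H * ?H))) = ?l - ?t * (?t * (?l * (?G * ?G)))"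
    by (simp add: algebra_simps)
  moreover have "?r * idn (Suc (k + l)) = ?r" "?l * idn (Suc (k + l)) = ?l"
    by (simp_all add: beta_num_def distrib_right mult.assoc)
  ultimately show ?thesis
    by (simp add: power2_eq_square right_diff_distrib tau dots_tau_left mult.assoc)
qed

text \<open>
  Replacing \<open>u\<close> by \<open>-u\<close> in a series of operators.  It commutes with products, and therefore maps
  \<open>beta_num \<sigma>\<close> to \<open>beta_num (- \<sigma>)\<close>; this relates \<open>\<beta>\<^sub>r(-u)\<close> to \<open>\<beta>\<^sub>l(u)\<close>.
\<close>

definition fps_alternate :: "'a::ring_1 fps \<Rightarrow> 'a fps" where
  "fps_alternate F = Abs_fps (\<lambda>n. (- 1) ^ n * fps_nth F n)"

lemma fps_alternate_nth [simp]: "fps_nth (fps_alternate F) n = (- 1) ^ n * fps_nth F n"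
  by (simp add: fps_alternate_def)

lemma fps_alternate_mult: "fps_alternate (F * G) = fps_alternate F * fps_alternate G"
proof (rule fps_ext)
  fix n
  have "(- 1) ^ n * (fps_nth F i * fps_nth G (n - i))
      = (- 1) ^ i * fps_nth F i * ((- 1) ^ (n - i) * fps_nth G (n - i))" if "i \<le> n" for i
  proof -
    have "(- 1) ^ n = (- 1 :: 'a) ^ i * (- 1) ^ (n - i)"
      using that by (simp flip: power_add)
    then have "(- 1) ^ n * (fps_nth F i * fps_nth G (n - i))
        = (- 1) ^ i * ((- 1) ^ (n - i) * fps_nth F i) * fps_nth G (n - i)"
      by (simp add: mult.assoc)
    also have "(- 1) ^ (n - i) * fps_nth F i = fps_nth F i * (- 1) ^ (n - i)"
      by (cases "even (n - i)") simp_all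
    finally show ?thesis
      by (simp add: mult.assoc)
  qed
  then show "fps_nth (fps_alternate (F * G)) n = fps_nth (fps_alternate F * fps_alternate G) n"
    by (auto simp only: fps_mult_nth fps_alternate_nth sum_distrib_left atLeastAtMost_iff intro!: sum.cong)
qed

lemma fps_alternate_add: "fps_alternate (F + G) = fps_alternate F + fps_alternate G"
  by (rule fps_ext) (simp add: distrib_left)

lemma fps_alternate_diff: "fps_alternate (F - G) = fps_alternate F - fps_alternate G"
  by (rule fps_ext) (simp add: right_diff_distrib)

lemma fps_alternate_const: "fps_alternate (fps_const c) = fps_const c"
  by (rule fps_ext) simp

lemma scalar_sign: "scalar ((- 1) ^ n) = (- 1) ^ n"
  by (induction n) (simp_all add: scalar_uminus scalar_mult)

lemma fps_alternate_ops: "fps_alternate (ops k f l) = ops k (series_neg_arg f) l"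
  by (rule fps_ext) (simp add: series_neg_arg_def wact_scale scalar_sign)

lemma fps_alternate_geo: "fps_alternate (geo_op \<sigma> k l) = geo_op (- \<sigma>) k l"
proof (rule fps_ext)
  fix n
  have "monom ((- \<sigma>) ^ n) n = smult ((- 1) ^ n) (monom (\<sigma> ^ n) n)"
    by (simp add: smult_monom power_minus[of \<sigma>])
  then have "poly_at_dot (monom ((- \<sigma>) ^ n) n) = (- 1) ^ n *\<^sub>A poly_at_dot (monom (\<sigma> ^ n) n)"
    by (intro act_inject[OF poly_at_dot_hom scale_hom[OF poly_at_dot_hom]])
      (simp add: act_poly_at_dot_smult act_scale)
  then show "fps_nth (fps_alternate (geo_op \<sigma> k l)) n = fps_nth (geo_op (- \<sigma>) k l) n"
    by (simp add: dots_nth geo_def wact_scale scalar_sign)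
qed

lemma fps_alternate_tau: "fps_alternate (tau \<sigma>) = tau (- \<sigma>)"
  by (rule fps_ext) (simp add: tau_def scalar_uminus le_Suc_eq)

lemma fps_alternate_beta_num: "fps_alternate (beta_num \<sigma> k l) = beta_num (- \<sigma>) k l"
proof -
  have "fps_alternate 2 = (2 :: 'a endo fps)"
    using fps_alternate_const[of 2] by (simp add: numeral_fps_const)
  moreover have "fps_alternate (bubble \<sigma> k l) = bubble (- \<sigma>) k l"
    by (simp add: bubble_def fps_alternate_mult fps_alternate_geo ops_const fps_alternate_const)
  moreover have "fps_alternate (idn n) = (idn n :: 'a endo fps)" for n
    by (simp add: idn_def ops_const fps_alternate_const)
  ultimately show ?thesis
    by (simp add: beta_num_def fps_alternate_mult fps_alternate_add fps_alternate_diff fps_alternate_tau)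
qed

lemma scal_two: "scal 2 = 2"
  using scal_add[of 1 1] by simp

lemma scal_X: "scal fps_X = tau 1"
  by (simp add: tau_def)

lemma scal_cancel:
  assumes "c * d = 1" "scal c * a = scal c * b"
  shows "a = b"
proof -
  have "scal d * scal c = (1 :: 'a endo fps)"
    using assms(1) scal_mult[of d c] by (simp add: mult.commute)
  moreover have "scal d * (scal c * a) = scal d * (scal c * b)"
    using assms(2) by simp
  ultimately show ?thesis
    by (simp flip: mult.assoc)
qed

lemma tau_one: "tau 1 = fps_X"
  unfolding tau_def by (rule fps_ext) simp

lemma dots_X: "dots k (fps_X * F) l = tau 1 * dots k F l"
  by (rule fps_ext) (simp add: tau_one dots_nth poly_at_dot_0)

lemma ops_y_ser: "ops k y_ser l = tau 1 * geo_op 1 k l"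
  by (simp add: y_ser_def y_fps_eq flip: dots_def dots_X)

lemma ops_w_ser: "ops k w_ser l = tau 1 * geo_op (- 1) k l"
  by (simp add: w_ser_def w_fps_eq flip: dots_def dots_X)

section \<open>The series of loops and the curls in the category\<close>

lemma y_ser_hom: "y_ser \<in> ser_hom 1 1" and w_ser_hom: "w_ser \<in> ser_hom 1 1"
  by (simp_all only: y_ser_def w_ser_def at_dot_ser_hom)

lemma beta_ser_hom: "beta_r \<in> ser_hom 0 0" "beta_l \<in> ser_hom 0 0"
  by (simp_all add: ser_hom_def beta_hom)

lemma loop_ser_hom:
  assumes "f \<in> ser_hom 1 1"
  shows "\<langle>ident 1\<rangle> \<otimes>\<^sub>S f \<in> ser_hom 2 2" "f \<otimes>\<^sub>S \<langle>ident 1\<rangle> \<in> ser_hom 2 2"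
  by (rule tensor_ser_hom[OF gen_ser_hom(1) assms] tensor_ser_hom[OF assms gen_ser_hom(1)]; simp)+

lemma ops_loop:
  assumes "f \<in> ser_hom 2 2"
  shows "ops k (\<langle>cap\<rangle> \<circ>\<^sub>S f \<circ>\<^sub>S \<langle>cup\<rangle>) l = cap_op k l * ops k f l * cup_op k l"
  by (simp add: ops_comp[OF comp_ser_hom[OF gen_ser_hom(2) assms] gen_ser_hom(3)]
      ops_comp[OF gen_ser_hom(2) assms])

lemma fps_quot_two:
  fixes g :: "'k::comm_ring_1 fps"
  assumes "(2 :: 'k) dvd 1" "fps_nth g 0 = 2"
  shows "fps_quot f g * g = f"
proof -
  from assms(1) obtain h :: 'k where "1 = 2 * h" by (rule dvdE)
  with assms(2) show ?thesis
    by (intro fps_quot_times[of g h]) (simp only:)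
qed

lemma ops_beta_r:
  assumes "(2 :: 'k::comm_ring_1) dvd 1"
  shows "scal (2 - fps_X) * ops k (beta_r :: 'k ab_series) l = beta_num 1 k l"
proof -
  let ?q = "fps_quot 2 (2 - fps_X :: 'k fps)"
  let ?L = "\<langle>cap\<rangle> \<circ>\<^sub>S (\<langle>ident 1\<rangle> \<otimes>\<^sub>S y_ser) \<circ>\<^sub>S \<langle>cup\<rangle> :: 'k ab_series"
  have L: "?L \<in> ser_hom 0 0"
    by (rule comp_ser_hom[OF comp_ser_hom[OF gen_ser_hom(2) loop_ser_hom(1)[OF y_ser_hom]] gen_ser_hom(3)])
  have "ops k ?L l = cap_op k l * (idn (Suc (Suc (k + l))) * (tau 1 * geo_op 1 (Suc k) l)) * cup_op k l"
    unfolding ops_loop[OF loop_ser_hom(1)[OF y_ser_hom]] ops_tensor[OF gen_ser_hom(1) y_ser_hom]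
    by (simp add: ops_ident ops_y_ser)
  also have "\<dots> = tau 1 * bubble 1 k l"
    by (simp add: bubble_def idn_tau_left ops_tau_left mult.assoc)
  finally have "ops k beta_r l = idn (k + l) + scal ?q * (tau 1 * bubble 1 k l)"
    unfolding beta_r_def ops_add[OF gen_ser_hom(1) scale_ser_hom[OF L]] ops_scale[OF L]
    by (simp add: ops_ident)
  moreover have "scal (2 - fps_X) * (scal ?q * a) = 2 * a" for a :: "'k endo fps"
    using fps_quot_two[OF assms, of "2 - fps_X" 2]
    by (simp add: mult.commute scal_two flip: mult.assoc scal_mult)
  ultimately show ?thesis
    by (simp add: beta_num_def distrib_left scal_diff scal_two scal_X)
qed

lemma ops_beta_l:
  assumes "(2 :: 'k::comm_ring_1) dvd 1"
  shows "scal (2 + fps_X) * ops k (beta_l :: 'k ab_series) l = - beta_num (- 1) k l"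
proof -
  let ?q = "fps_quot 2 (2 + fps_X :: 'k fps)"
  let ?L = "\<langle>cap\<rangle> \<circ>\<^sub>S (y_ser \<otimes>\<^sub>S \<langle>ident 1\<rangle>) \<circ>\<^sub>S \<langle>cup\<rangle> :: 'k ab_series"
  have L: "?L \<in> ser_hom 0 0"
    by (rule comp_ser_hom[OF comp_ser_hom[OF gen_ser_hom(2) loop_ser_hom(2)[OF y_ser_hom]] gen_ser_hom(3)])
  have "ops k ?L l = cap_op k l * ((tau 1 * geo_op 1 k (Suc l)) * idn (Suc (Suc (k + l)))) * cup_op k l"
    unfolding ops_loop[OF loop_ser_hom(2)[OF y_ser_hom]] ops_tensor[OF y_ser_hom gen_ser_hom(1)]
    by (simp add: ops_ident ops_y_ser)
  also have "\<dots> = tau 1 * bubble (- 1) k l"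
    by (simp add: ops_tau_left mult.assoc loop_left)
  finally have beta: "ops k beta_l l = - idn (k + l) + scal ?q * (tau 1 * bubble (- 1) k l)"
    unfolding beta_l_def ops_add[OF uminus_ser_hom[OF gen_ser_hom(1)] scale_ser_hom[OF L]] ops_scale[OF L]
    by (simp add: ops_ident ops_uminus)
  have cancel: "scal (2 + fps_X) * (scal ?q * a) = 2 * a" for a :: "'k endo fps"
    using fps_quot_two[OF assms, of "2 + fps_X" 2]
    by (simp add: mult.commute scal_two flip: mult.assoc scal_mult)
  show ?thesis
    unfolding beta distrib_left cancel
    by (simp add: beta_num_def scal_add scal_two scal_X tau_uminus)
qed

lemma invertible_two_minus:
  assumes "(2 :: 'k::comm_ring_1) dvd 1"
  obtains d where "(2 - fps_X :: 'k fps) * d = 1"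
  using fps_quot_two[OF assms, of "2 - fps_X" 1]
  by (intro that[of "fps_quot 1 (2 - fps_X)"]) (simp add: mult.commute)

lemma invertible_two_plus:
  assumes "(2 :: 'k::comm_ring_1) dvd 1"
  obtains d where "(2 + fps_X :: 'k fps) * d = 1"
  using fps_quot_two[OF assms, of "2 + fps_X" 1]
  by (intro that[of "fps_quot 1 (2 + fps_X)"]) (simp add: mult.commute)

lemma two_cancel:
  fixes a b :: "'k::comm_ring_1 endo fps"
  assumes "(2 :: 'k) dvd 1" "2 * a = 2 * b"
  shows "a = b"
proof -
  from assms(1) obtain h :: 'k where "1 = 2 * h" by (rule dvdE)
  from this[symmetric] have "(2 :: 'k fps) * fps_const h = 1"
    by (simp add: numeral_fps_const)
  then show ?thesis
    by (rule scal_cancel) (simp only: scal_two assms(2))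
qed

lemma beta_l_eq:
  assumes "(2 :: 'k::comm_ring_1) dvd 1"
  shows "(beta_l :: 'k ab_series) = -\<^sub>S series_neg_arg beta_r"
proof (rule ops_inject)
  show "beta_l \<in> ser_hom 0 0" by (rule beta_ser_hom)
  show "-\<^sub>S series_neg_arg beta_r \<in> ser_hom 0 0"
    using beta_ser_hom(1) by (intro uminus_ser_hom) (auto simp: ser_hom_def series_neg_arg_def intro: scale_hom)
  have "fps_alternate (scal (2 - fps_X) :: 'k endo fps) = scal (2 + fps_X)"
    by (simp add: scal_diff scal_add scal_X scal_two fps_alternate_diff fps_alternate_tau tau_uminus)
      (simp add: numeral_fps_const fps_alternate_const)
  then have "scal (2 + fps_X) * ops 0 (series_neg_arg beta_r :: 'k ab_series) 0
      = fps_alternate (scal (2 - fps_X) * ops 0 beta_r 0)"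
    by (simp add: fps_alternate_mult fps_alternate_ops)
  also have "\<dots> = beta_num (- 1) 0 0"
    by (simp add: ops_beta_r[OF assms] fps_alternate_beta_num)
  finally have "scal (2 + fps_X) * ops 0 (beta_l :: 'k ab_series) 0
      = scal (2 + fps_X) * ops 0 (-\<^sub>S series_neg_arg beta_r) 0"
    by (simp add: ops_beta_l[OF assms] ops_uminus)
  moreover obtain d where "(2 + fps_X :: 'k fps) * d = 1"
    by (rule invertible_two_plus[OF assms])
  ultimately show "ops 0 (beta_l :: 'k ab_series) 0 = ops 0 (-\<^sub>S series_neg_arg beta_r) 0"
    by (rule scal_cancel[rotated])
qed

lemma beta_l_beta_r:
  assumes "(2 :: 'k::comm_ring_1) dvd 1"
  shows "(beta_l :: 'k ab_series) \<circ>\<^sub>S beta_r = -\<^sub>S \<langle>ident 0\<rangle>"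
proof (rule ops_inject)
  show "beta_l \<circ>\<^sub>S beta_r \<in> ser_hom 0 0" "-\<^sub>S \<langle>ident 0\<rangle> \<in> ser_hom 0 0"
    by (rule comp_ser_hom[OF beta_ser_hom(2,1)] uminus_ser_hom[OF gen_ser_hom(1)])+
  let ?l = "ops 0 beta_l 0 :: 'k endo fps" and ?r = "ops 0 beta_r 0 :: 'k endo fps"
  have "scal (2 - fps_X) * (scal (2 + fps_X) * (?l * ?r))
      = (scal (2 + fps_X) * ?l) * (scal (2 - fps_X) * ?r)"
    by (simp add: ops_scal_left mult.assoc) (simp add: scal_commute flip: mult.assoc)
  also have "\<dots> = - beta_num (- 1) 0 0 * beta_num 1 0 0"
    by (simp only: ops_beta_l[OF assms] ops_beta_r[OF assms])
  also have "\<dots> = scal (2 - fps_X) * (scal (2 + fps_X) * - idn 0)"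
    by (simp add: beta_num_inverse scal_diff scal_add scal_two scal_X)
  finally have *: "scal (2 - fps_X) * (scal (2 + fps_X) * (?l * ?r)) = \<dots>" .
  obtain d where d: "(2 - fps_X :: 'k fps) * d = 1"
    by (rule invertible_two_minus[OF assms])
  obtain e where e: "(2 + fps_X :: 'k fps) * e = 1"
    by (rule invertible_two_plus[OF assms])
  have "?l * ?r = - idn 0"
    by (rule scal_cancel[OF e scal_cancel[OF d *]])
  then show "ops 0 (beta_l \<circ>\<^sub>S beta_r) 0 = (ops 0 (-\<^sub>S \<langle>ident 0\<rangle>) 0 :: 'k endo fps)"
    by (simp add: ops_comp[OF beta_ser_hom(2,1)] ops_uminus ops_ident)
qed

lemma curl_ser_hom:
  assumes "f \<in> ser_hom 1 1"
  shows "\<langle>ident 1\<rangle> \<otimes>\<^sub>S \<langle>cap\<rangle> \<in> ser_hom 3 1" "\<langle>cross\<rangle> \<otimes>\<^sub>S f \<in> ser_hom 3 3" "\<langle>ident 1\<rangle> \<otimes>\<^sub>S \<langle>cup\<rangle> \<in> ser_hom 1 3"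
    "\<langle>cap\<rangle> \<otimes>\<^sub>S \<langle>ident 1\<rangle> \<in> ser_hom 3 1" "f \<otimes>\<^sub>S \<langle>cross\<rangle> \<in> ser_hom 3 3" "\<langle>cup\<rangle> \<otimes>\<^sub>S \<langle>ident 1\<rangle> \<in> ser_hom 1 3"
  by (rule tensor_ser_hom[OF gen_ser_hom(1) gen_ser_hom(2)] tensor_ser_hom[OF gen_ser_hom(4) assms]
      tensor_ser_hom[OF gen_ser_hom(1) gen_ser_hom(3)] tensor_ser_hom[OF gen_ser_hom(2) gen_ser_hom(1)]
      tensor_ser_hom[OF assms gen_ser_hom(4)] tensor_ser_hom[OF gen_ser_hom(3) gen_ser_hom(1)]; simp)+

lemma ops_curl_right:
  assumes f: "f \<in> ser_hom 1 1"
  shows "(\<langle>ident 1\<rangle> \<otimes>\<^sub>S \<langle>cap\<rangle>) \<circ>\<^sub>S (\<langle>cross\<rangle> \<otimes>\<^sub>S f) \<circ>\<^sub>S (\<langle>ident 1\<rangle> \<otimes>\<^sub>S \<langle>cup\<rangle>) \<in> ser_hom 1 1"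
    and "ops 0 ((\<langle>ident 1\<rangle> \<otimes>\<^sub>S \<langle>cap\<rangle>) \<circ>\<^sub>S (\<langle>cross\<rangle> \<otimes>\<^sub>S f) \<circ>\<^sub>S (\<langle>ident 1\<rangle> \<otimes>\<^sub>S \<langle>cup\<rangle>)) 0
      = cap_op (Suc 0) 0 * (cross_op 0 (Suc 0) * ops (Suc (Suc 0)) f 0) * cup_op (Suc 0) 0"
proof -
  note h = curl_ser_hom[OF f]
  show "(\<langle>ident 1\<rangle> \<otimes>\<^sub>S \<langle>cap\<rangle>) \<circ>\<^sub>S (\<langle>cross\<rangle> \<otimes>\<^sub>S f) \<circ>\<^sub>S (\<langle>ident 1\<rangle> \<otimes>\<^sub>S \<langle>cup\<rangle>) \<in> ser_hom 1 1"
    by (rule comp_ser_hom[OF comp_ser_hom[OF h(1,2)] h(3)])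
  show "ops 0 ((\<langle>ident 1\<rangle> \<otimes>\<^sub>S \<langle>cap\<rangle>) \<circ>\<^sub>S (\<langle>cross\<rangle> \<otimes>\<^sub>S f) \<circ>\<^sub>S (\<langle>ident 1\<rangle> \<otimes>\<^sub>S \<langle>cup\<rangle>)) 0
      = cap_op (Suc 0) 0 * (cross_op 0 (Suc 0) * ops (Suc (Suc 0)) f 0) * cup_op (Suc 0) 0"
    unfolding ops_comp[OF comp_ser_hom[OF h(1,2)] h(3)] ops_comp[OF h(1,2)]
      ops_tensor[OF gen_ser_hom(1) gen_ser_hom(2)] ops_tensor[OF gen_ser_hom(4) f]
      ops_tensor[OF gen_ser_hom(1) gen_ser_hom(3)]
    by (simp add: ops_ident mult.assoc numeral_2_eq_2)
qed

lemma ops_curl_left: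
  assumes f: "f \<in> ser_hom 1 1"
  shows "(\<langle>cap\<rangle> \<otimes>\<^sub>S \<langle>ident 1\<rangle>) \<circ>\<^sub>S (f \<otimes>\<^sub>S \<langle>cross\<rangle>) \<circ>\<^sub>S (\<langle>cup\<rangle> \<otimes>\<^sub>S \<langle>ident 1\<rangle>) \<in> ser_hom 1 1"
    and "ops 0 ((\<langle>cap\<rangle> \<otimes>\<^sub>S \<langle>ident 1\<rangle>) \<circ>\<^sub>S (f \<otimes>\<^sub>S \<langle>cross\<rangle>) \<circ>\<^sub>S (\<langle>cup\<rangle> \<otimes>\<^sub>S \<langle>ident 1\<rangle>)) 0
      = cap_op 0 (Suc 0) * (ops 0 f (Suc (Suc 0)) * cross_op (Suc 0) 0) * cup_op 0 (Suc 0)"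
proof -
  note h = curl_ser_hom[OF f]
  show "(\<langle>cap\<rangle> \<otimes>\<^sub>S \<langle>ident 1\<rangle>) \<circ>\<^sub>S (f \<otimes>\<^sub>S \<langle>cross\<rangle>) \<circ>\<^sub>S (\<langle>cup\<rangle> \<otimes>\<^sub>S \<langle>ident 1\<rangle>) \<in> ser_hom 1 1"
    by (rule comp_ser_hom[OF comp_ser_hom[OF h(4,5)] h(6)])
  show "ops 0 ((\<langle>cap\<rangle> \<otimes>\<^sub>S \<langle>ident 1\<rangle>) \<circ>\<^sub>S (f \<otimes>\<^sub>S \<langle>cross\<rangle>) \<circ>\<^sub>S (\<langle>cup\<rangle> \<otimes>\<^sub>S \<langle>ident 1\<rangle>)) 0
      = cap_op 0 (Suc 0) * (ops 0 f (Suc (Suc 0)) * cross_op (Suc 0) 0) * cup_op 0 (Suc 0)"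
    unfolding ops_comp[OF comp_ser_hom[OF h(4,5)] h(6)] ops_comp[OF h(4,5)]
      ops_tensor[OF gen_ser_hom(2) gen_ser_hom(1)] ops_tensor[OF f gen_ser_hom(4)]
      ops_tensor[OF gen_ser_hom(3) gen_ser_hom(1)]
    by (simp add: ops_ident mult.assoc numeral_2_eq_2)
qed

lemma two_scal_half:
  assumes "(2 :: 'k::comm_ring_1) dvd 1"
  shows "2 * (scal (fps_quot fps_X 2 :: 'k fps) * a) = tau 1 * a"
    and "2 * (scal (1 - fps_quot fps_X 2 :: 'k fps) * a) = scal (2 - fps_X) * a"
    and "2 * (scal (- (1 + fps_quot fps_X 2) :: 'k fps) * a) = - (scal (2 + fps_X) * a)"
proof -
  have "fps_quot fps_X 2 * 2 = (fps_X :: 'k fps)"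
    by (rule fps_quot_two[OF assms]) (simp add: numeral_fps_const)
  then have "2 * scal (fps_quot fps_X 2 :: 'k fps) = tau 1"
    by (simp add: mult.commute flip: scal_two scal_mult scal_X)
  then show *: "2 * (scal (fps_quot fps_X 2 :: 'k fps) * a) = tau 1 * a" for a
    by (simp flip: mult.assoc)
  show "2 * (scal (1 - fps_quot fps_X 2 :: 'k fps) * a) = scal (2 - fps_X) * a"
    by (simp add: scal_diff left_diff_distrib right_diff_distrib * scal_two scal_X)
  show "2 * (scal (- (1 + fps_quot fps_X 2) :: 'k fps) * a) = - (scal (2 + fps_X) * a)"
    using *[of a] by (simp add: scal_uminus scal_add scal_diff scal_two scal_X algebra_simps)
qed

text \<open>
  In the products below the scalars have to be collected in front of a loop series, where
  \<open>ops_beta_r\<close> and \<open>ops_beta_l\<close> apply.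
\<close>

lemma scal_past_left: "scal c * (tau \<sigma> * (dots k F l * b)) = tau \<sigma> * (dots k F l * (scal c * b))"
  and scal_past_right: "scal c * (ops i f j * (tau \<sigma> * dots k F l)) = (scal c * ops i f j) * (tau \<sigma> * dots k F l)"
  by (simp_all add: dots_scal_left tau_scal_left mult.assoc)

lemma tau_past:
  "cap_op a b * (cross_op c d * (tau \<sigma> * r)) * s = tau \<sigma> * (cap_op a b * (cross_op c d * r) * s)"
  "cap_op a b * ((tau \<sigma> * r) * t) * s = tau \<sigma> * (cap_op a b * (r * t) * s)"
  by (simp_all add: ops_tau_left mult.assoc)

lemma two_past_tau: "2 * (tau \<sigma> * a) = tau \<sigma> * (2 * a)"
  by (simp add: mult_2 distrib_left)

lemma beta_num_tau_left: "beta_num \<rho> k l * (tau \<sigma> * a) = tau \<sigma> * (beta_num \<rho> k l * a)"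
proof -
  have "tau \<rho> * (tau \<sigma> * b) = tau \<sigma> * (tau \<rho> * b)" for b
    unfolding tau_def by (simp add: scal_commute flip: mult.assoc)
  then show ?thesis
    by (simp add: beta_num_def mult_2 algebra_simps bubble_tau_left idn_tau_left)
qed

text \<open>
  In this and the next three lemmas both sides are doubled and multiplied out; they agree by
  \<open>curl_right_beta_num\<close> or \<open>curl_left_beta_num\<close>, taken at \<open>\<sigma> = 1\<close> for \<open>y\<close> and at \<open>\<sigma> = -1\<close> for \<open>w\<close>.
\<close>

lemma curl_right_y:
  assumes "(2 :: 'k::comm_ring_1) dvd 1"
  shows "(\<langle>ident 1\<rangle> \<otimes>\<^sub>S \<langle>cap\<rangle>) \<circ>\<^sub>S (\<langle>cross\<rangle> \<otimes>\<^sub>S y_ser) \<circ>\<^sub>S (\<langle>ident 1\<rangle> \<otimes>\<^sub>S \<langle>cup\<rangle>) =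
    (1 - fps_quot fps_X 2 :: 'k fps) *\<^sub>S (w_ser \<otimes>\<^sub>S beta_r) -\<^sub>S fps_quot fps_X 2 *\<^sub>S y_ser"
proof (rule ops_inject[OF ops_curl_right(1)[OF y_ser_hom]])
  have t: "w_ser \<otimes>\<^sub>S beta_r \<in> (ser_hom 1 1 :: 'k ab_series set)"
    by (rule tensor_ser_hom[OF w_ser_hom beta_ser_hom(1)]) simp_all
  show "(1 - fps_quot fps_X 2 :: 'k fps) *\<^sub>S (w_ser \<otimes>\<^sub>S beta_r) -\<^sub>S fps_quot fps_X 2 *\<^sub>S y_ser \<in> ser_hom 1 1"
    by (intro diff_ser_hom scale_ser_hom t y_ser_hom)
  have "2 * ops 0 ((\<langle>ident 1\<rangle> \<otimes>\<^sub>S \<langle>cap\<rangle>) \<circ>\<^sub>S (\<langle>cross\<rangle> \<otimes>\<^sub>S y_ser) \<circ>\<^sub>S (\<langle>ident 1\<rangle> \<otimes>\<^sub>S \<langle>cup\<rangle>)) 0 =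
    tau 1 * (geo_op ((- 1) :: 'k) 0 0 * beta_num 1 (Suc 0) 0) - tau 1 * (tau 1 * geo_op 1 0 0)"
    unfolding ops_curl_right(2)[OF y_ser_hom] ops_y_ser tau_past two_past_tau curl_right_beta_num
    by (simp add: beta_num_dots distrib_left right_diff_distrib tau_uminus)
  also have "\<dots> = 2 * ops 0 ((1 - fps_quot fps_X 2 :: 'k fps) *\<^sub>S (w_ser \<otimes>\<^sub>S beta_r) -\<^sub>S fps_quot fps_X 2 *\<^sub>S y_ser) 0"
    unfolding ops_diff[OF scale_ser_hom[OF t] scale_ser_hom[OF y_ser_hom]] ops_scale[OF t]
      ops_scale[OF y_ser_hom] ops_tensor[OF w_ser_hom beta_ser_hom(1)]
      distrib_left right_diff_distrib two_scal_half[OF assms] ops_y_ser ops_w_ser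
    by (simp add: scal_past_left scal_past_right ops_beta_r[OF assms] beta_num_tau_left beta_num_dots mult.assoc)
  finally show "ops 0 ((\<langle>ident 1\<rangle> \<otimes>\<^sub>S \<langle>cap\<rangle>) \<circ>\<^sub>S (\<langle>cross\<rangle> \<otimes>\<^sub>S y_ser) \<circ>\<^sub>S (\<langle>ident 1\<rangle> \<otimes>\<^sub>S \<langle>cup\<rangle>)) 0 = ops 0 ((1 - fps_quot fps_X 2 :: 'k fps) *\<^sub>S (w_ser \<otimes>\<^sub>S beta_r) -\<^sub>S fps_quot fps_X 2 *\<^sub>S y_ser) 0"
    by (rule two_cancel[OF assms])
qed

lemma curl_left_y:
  assumes "(2 :: 'k::comm_ring_1) dvd 1"
  shows "(\<langle>cap\<rangle> \<otimes>\<^sub>S \<langle>ident 1\<rangle>) \<circ>\<^sub>S (y_ser \<otimes>\<^sub>S \<langle>cross\<rangle>) \<circ>\<^sub>S (\<langle>cup\<rangle> \<otimes>\<^sub>S \<langle>ident 1\<rangle>) =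
    (- (1 + fps_quot fps_X 2) :: 'k fps) *\<^sub>S (beta_l \<otimes>\<^sub>S w_ser) +\<^sub>S fps_quot fps_X 2 *\<^sub>S y_ser"
proof (rule ops_inject[OF ops_curl_left(1)[OF y_ser_hom]])
  have t: "beta_l \<otimes>\<^sub>S w_ser \<in> (ser_hom 1 1 :: 'k ab_series set)"
    by (rule tensor_ser_hom[OF beta_ser_hom(2) w_ser_hom]) simp_all
  show "(- (1 + fps_quot fps_X 2) :: 'k fps) *\<^sub>S (beta_l \<otimes>\<^sub>S w_ser) +\<^sub>S fps_quot fps_X 2 *\<^sub>S y_ser \<in> ser_hom 1 1"
    by (intro add_ser_hom scale_ser_hom t y_ser_hom)
  have "2 * ops 0 ((\<langle>cap\<rangle> \<otimes>\<^sub>S \<langle>ident 1\<rangle>) \<circ>\<^sub>S (y_ser \<otimes>\<^sub>S \<langle>cross\<rangle>) \<circ>\<^sub>S (\<langle>cup\<rangle> \<otimes>\<^sub>S \<langle>ident 1\<rangle>)) 0 =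
    tau 1 * (geo_op ((- 1) :: 'k) 0 0 * beta_num (- 1) 0 (Suc 0)) + tau 1 * (tau 1 * geo_op 1 0 0)"
    unfolding ops_curl_left(2)[OF y_ser_hom] ops_y_ser tau_past two_past_tau curl_left_beta_num
    by (simp add: beta_num_dots distrib_left right_diff_distrib tau_uminus)
  also have "\<dots> = 2 * ops 0 ((- (1 + fps_quot fps_X 2) :: 'k fps) *\<^sub>S (beta_l \<otimes>\<^sub>S w_ser) +\<^sub>S fps_quot fps_X 2 *\<^sub>S y_ser) 0"
    unfolding ops_add[OF scale_ser_hom[OF t] scale_ser_hom[OF y_ser_hom]] ops_scale[OF t]
      ops_scale[OF y_ser_hom] ops_tensor[OF beta_ser_hom(2) w_ser_hom]
      distrib_left right_diff_distrib two_scal_half[OF assms] ops_y_ser ops_w_ser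
    by (simp add: scal_past_left scal_past_right ops_beta_l[OF assms] beta_num_tau_left beta_num_dots mult.assoc)
  finally show "ops 0 ((\<langle>cap\<rangle> \<otimes>\<^sub>S \<langle>ident 1\<rangle>) \<circ>\<^sub>S (y_ser \<otimes>\<^sub>S \<langle>cross\<rangle>) \<circ>\<^sub>S (\<langle>cup\<rangle> \<otimes>\<^sub>S \<langle>ident 1\<rangle>)) 0 = ops 0 ((- (1 + fps_quot fps_X 2) :: 'k fps) *\<^sub>S (beta_l \<otimes>\<^sub>S w_ser) +\<^sub>S fps_quot fps_X 2 *\<^sub>S y_ser) 0"
    by (rule two_cancel[OF assms])
qed

lemma curl_right_w:
  assumes "(2 :: 'k::comm_ring_1) dvd 1"
  shows "(\<langle>ident 1\<rangle> \<otimes>\<^sub>S \<langle>cap\<rangle>) \<circ>\<^sub>S (\<langle>cross\<rangle> \<otimes>\<^sub>S w_ser) \<circ>\<^sub>S (\<langle>ident 1\<rangle> \<otimes>\<^sub>S \<langle>cup\<rangle>) =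
    (- (1 + fps_quot fps_X 2) :: 'k fps) *\<^sub>S (y_ser \<otimes>\<^sub>S beta_l) +\<^sub>S fps_quot fps_X 2 *\<^sub>S w_ser"
proof (rule ops_inject[OF ops_curl_right(1)[OF w_ser_hom]])
  have t: "y_ser \<otimes>\<^sub>S beta_l \<in> (ser_hom 1 1 :: 'k ab_series set)"
    by (rule tensor_ser_hom[OF y_ser_hom beta_ser_hom(2)]) simp_all
  show "(- (1 + fps_quot fps_X 2) :: 'k fps) *\<^sub>S (y_ser \<otimes>\<^sub>S beta_l) +\<^sub>S fps_quot fps_X 2 *\<^sub>S w_ser \<in> ser_hom 1 1"
    by (intro add_ser_hom scale_ser_hom t w_ser_hom)
  have "2 * ops 0 ((\<langle>ident 1\<rangle> \<otimes>\<^sub>S \<langle>cap\<rangle>) \<circ>\<^sub>S (\<langle>cross\<rangle> \<otimes>\<^sub>S w_ser) \<circ>\<^sub>S (\<langle>ident 1\<rangle> \<otimes>\<^sub>S \<langle>cup\<rangle>)) 0 =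
    tau 1 * (geo_op (1 :: 'k) 0 0 * beta_num (- 1) (Suc 0) 0) + tau 1 * (tau 1 * geo_op (- 1) 0 0)"
    unfolding ops_curl_right(2)[OF w_ser_hom] ops_w_ser tau_past two_past_tau curl_right_beta_num
    by (simp add: beta_num_dots distrib_left right_diff_distrib tau_uminus)
  also have "\<dots> = 2 * ops 0 ((- (1 + fps_quot fps_X 2) :: 'k fps) *\<^sub>S (y_ser \<otimes>\<^sub>S beta_l) +\<^sub>S fps_quot fps_X 2 *\<^sub>S w_ser) 0"
    unfolding ops_add[OF scale_ser_hom[OF t] scale_ser_hom[OF w_ser_hom]] ops_scale[OF t]
      ops_scale[OF w_ser_hom] ops_tensor[OF y_ser_hom beta_ser_hom(2)]
      distrib_left right_diff_distrib two_scal_half[OF assms] ops_y_ser ops_w_ser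
    by (simp add: scal_past_left scal_past_right ops_beta_l[OF assms] beta_num_tau_left beta_num_dots mult.assoc)
  finally show "ops 0 ((\<langle>ident 1\<rangle> \<otimes>\<^sub>S \<langle>cap\<rangle>) \<circ>\<^sub>S (\<langle>cross\<rangle> \<otimes>\<^sub>S w_ser) \<circ>\<^sub>S (\<langle>ident 1\<rangle> \<otimes>\<^sub>S \<langle>cup\<rangle>)) 0 = ops 0 ((- (1 + fps_quot fps_X 2) :: 'k fps) *\<^sub>S (y_ser \<otimes>\<^sub>S beta_l) +\<^sub>S fps_quot fps_X 2 *\<^sub>S w_ser) 0"
    by (rule two_cancel[OF assms])
qed

lemma curl_left_w:
  assumes "(2 :: 'k::comm_ring_1) dvd 1"
  shows "(\<langle>cap\<rangle> \<otimes>\<^sub>S \<langle>ident 1\<rangle>) \<circ>\<^sub>S (w_ser \<otimes>\<^sub>S \<langle>cross\<rangle>) \<circ>\<^sub>S (\<langle>cup\<rangle> \<otimes>\<^sub>S \<langle>ident 1\<rangle>) =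
    (1 - fps_quot fps_X 2 :: 'k fps) *\<^sub>S (beta_r \<otimes>\<^sub>S y_ser) -\<^sub>S fps_quot fps_X 2 *\<^sub>S w_ser"
proof (rule ops_inject[OF ops_curl_left(1)[OF w_ser_hom]])
  have t: "beta_r \<otimes>\<^sub>S y_ser \<in> (ser_hom 1 1 :: 'k ab_series set)"
    by (rule tensor_ser_hom[OF beta_ser_hom(1) y_ser_hom]) simp_all
  show "(1 - fps_quot fps_X 2 :: 'k fps) *\<^sub>S (beta_r \<otimes>\<^sub>S y_ser) -\<^sub>S fps_quot fps_X 2 *\<^sub>S w_ser \<in> ser_hom 1 1"
    by (intro diff_ser_hom scale_ser_hom t w_ser_hom)
  have "2 * ops 0 ((\<langle>cap\<rangle> \<otimes>\<^sub>S \<langle>ident 1\<rangle>) \<circ>\<^sub>S (w_ser \<otimes>\<^sub>S \<langle>cross\<rangle>) \<circ>\<^sub>S (\<langle>cup\<rangle> \<otimes>\<^sub>S \<langle>ident 1\<rangle>)) 0 =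
    tau 1 * (geo_op (1 :: 'k) 0 0 * beta_num 1 0 (Suc 0)) - tau 1 * (tau 1 * geo_op (- 1) 0 0)"
    unfolding ops_curl_left(2)[OF w_ser_hom] ops_w_ser tau_past two_past_tau curl_left_beta_num
    by (simp add: beta_num_dots distrib_left right_diff_distrib tau_uminus)
  also have "\<dots> = 2 * ops 0 ((1 - fps_quot fps_X 2 :: 'k fps) *\<^sub>S (beta_r \<otimes>\<^sub>S y_ser) -\<^sub>S fps_quot fps_X 2 *\<^sub>S w_ser) 0"
    unfolding ops_diff[OF scale_ser_hom[OF t] scale_ser_hom[OF w_ser_hom]] ops_scale[OF t]
      ops_scale[OF w_ser_hom] ops_tensor[OF beta_ser_hom(1) y_ser_hom]
      distrib_left right_diff_distrib two_scal_half[OF assms] ops_y_ser ops_w_ser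
    by (simp add: scal_past_left scal_past_right ops_beta_r[OF assms] beta_num_tau_left beta_num_dots mult.assoc)
  finally show "ops 0 ((\<langle>cap\<rangle> \<otimes>\<^sub>S \<langle>ident 1\<rangle>) \<circ>\<^sub>S (w_ser \<otimes>\<^sub>S \<langle>cross\<rangle>) \<circ>\<^sub>S (\<langle>cup\<rangle> \<otimes>\<^sub>S \<langle>ident 1\<rangle>)) 0 = ops 0 ((1 - fps_quot fps_X 2 :: 'k fps) *\<^sub>S (beta_r \<otimes>\<^sub>S y_ser) -\<^sub>S fps_quot fps_X 2 *\<^sub>S w_ser) 0"
    by (rule two_cancel[OF assms])
qed

lemma dots_square: "dots k (F\<^sup>2) l = (dots k F l)\<^sup>2"
  by (simp add: power2_eq_square dots_mult)

text \<open>
  Here \<open>F\<close> and \<open>G\<close> stand for \<open>\<tau> / (1 - \<tau> x)\<close> and \<open>\<tau> / (1 + \<tau> x)\<close> up to sign, so that \<open>y\<close> and \<open>w\<close> may be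
  inserted both for \<open>\<sigma> = 1\<close> and, exchanged, for \<open>\<sigma> = -1\<close>.  The invertible
  scalar \<open>c\<close> clears the denominator of \<open>\<beta>\<close>, and \<open>e\<close> accounts for the sign in \<open>\<beta>\<^sub>l\<close>.
\<close>

lemma beta_slide:
  fixes \<beta> :: "'k::comm_ring_1 ab_series"
  assumes \<beta>: "\<beta> \<in> ser_hom 0 0"
    and num: "\<And>k l. scal c * ops k \<beta> l = scal e * beta_num \<sigma> k l" and c: "c * d = 1"
    and F: "dots 0 (F\<^sup>2) 0 = (tau \<sigma> * geo_op \<sigma> 0 0)\<^sup>2" "fps_nth F 0 = 0"
    and G: "dots 0 (G\<^sup>2) 0 = (tau \<sigma> * geo_op (- \<sigma>) 0 0)\<^sup>2"
  shows "\<beta> \<otimes>\<^sub>S \<langle>ident 1\<rangle> = at_dot (fps_quot (1 - G\<^sup>2) (1 - F\<^sup>2)) \<otimes>\<^sub>S \<beta>"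
proof (rule ops_inject)
  let ?q = "fps_quot (1 - G\<^sup>2) (1 - F\<^sup>2)" and ?i = "fps_right_inverse (1 - F\<^sup>2) 1"
  let ?l = "ops 0 \<beta> (Suc 0)" and ?r = "ops (Suc 0) \<beta> 0"
  have F0: "fps_nth (1 - F\<^sup>2) 0 * 1 = 1"
    by (simp add: power2_eq_square F(2))
  show "\<beta> \<otimes>\<^sub>S \<langle>ident 1\<rangle> \<in> ser_hom 1 1"
    by (rule tensor_ser_hom[OF \<beta> gen_ser_hom(1)]) simp_all
  show "at_dot ?q \<otimes>\<^sub>S \<beta> \<in> ser_hom 1 1"
    by (rule tensor_ser_hom[OF at_dot_ser_hom \<beta>]) simp_all
  have "beta_num \<sigma> (Suc 0) 0 * dots 0 (1 - G\<^sup>2) 0 = beta_num \<sigma> 0 (Suc 0) * dots 0 (1 - F\<^sup>2) 0"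
    using beta_num_slide[of \<sigma> 0 0] by (simp add: dots_diff dots_one F G)
  then have "(scal e * beta_num \<sigma> (Suc 0) 0) * dots 0 (1 - G\<^sup>2) 0
      = (scal e * beta_num \<sigma> 0 (Suc 0)) * dots 0 (1 - F\<^sup>2) 0"
    by (simp add: mult.assoc)
  then have "scal c * (?r * dots 0 (1 - G\<^sup>2) 0) = scal c * (?l * dots 0 (1 - F\<^sup>2) 0)"
    by (simp add: mult.assoc flip: num)
  then have slide: "?r * dots 0 (1 - G\<^sup>2) 0 = ?l * dots 0 (1 - F\<^sup>2) 0"
    by (rule scal_cancel[OF c])
  have "dots 0 ?q 0 * dots 0 (1 - F\<^sup>2) 0 = dots 0 (1 - G\<^sup>2) 0"
    by (simp only: dots_mult[symmetric] fps_quot_times[OF F0])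
  with slide have "?r * dots 0 ?q 0 * dots 0 (1 - F\<^sup>2) 0 = ?l * dots 0 (1 - F\<^sup>2) 0"
    by (simp only: mult.assoc)
  then have "?r * dots 0 ?q 0 * (dots 0 (1 - F\<^sup>2) 0 * dots 0 ?i 0) = ?l * (dots 0 (1 - F\<^sup>2) 0 * dots 0 ?i 0)"
    by (simp flip: mult.assoc)
  moreover have "dots 0 (1 - F\<^sup>2) 0 * dots 0 ?i 0 = idn (Suc 0)"
    unfolding dots_mult[symmetric] fps_right_inverse[OF F0] by (simp add: dots_one)
  ultimately have "?r * dots 0 ?q 0 = ?l"
    using idn_ops(2)[OF \<beta>, of 0 "Suc 0"] by (simp add: mult.assoc)
  moreover have "dots 0 ?q 0 * ?r = ?r * dots 0 ?q 0"
    unfolding dots_def by (rule interchange[OF at_dot_ser_hom \<beta>, where p = 0]) simp_all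
  ultimately show "ops 0 (\<beta> \<otimes>\<^sub>S \<langle>ident 1\<rangle>) 0 = ops 0 (at_dot ?q \<otimes>\<^sub>S \<beta>) 0"
    unfolding ops_tensor[OF \<beta> gen_ser_hom(1)] ops_tensor[OF at_dot_ser_hom \<beta>]
    using idn_ops(2)[OF \<beta>, of 0 "Suc 0"] by (simp add: ops_ident dots_def)
qed

lemma beta_slides:
  assumes "(2 :: 'k::comm_ring_1) dvd 1"
  shows "(beta_r :: 'k ab_series) \<otimes>\<^sub>S \<langle>ident 1\<rangle> =
      at_dot (fps_quot (1 - w_fps ^ 2) (1 - y_fps ^ 2)) \<otimes>\<^sub>S beta_r"
    and "(beta_l :: 'k ab_series) \<otimes>\<^sub>S \<langle>ident 1\<rangle> =
      at_dot (fps_quot (1 - y_fps ^ 2) (1 - w_fps ^ 2)) \<otimes>\<^sub>S beta_l"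
proof -
  obtain d where d: "(2 - fps_X :: 'k fps) * d = 1"
    by (rule invertible_two_minus[OF assms])
  obtain e where e: "(2 + fps_X :: 'k fps) * e = 1"
    by (rule invertible_two_plus[OF assms])
  have yw: "dots 0 (y_fps\<^sup>2) 0 = (tau 1 * geo_op (1 :: 'k) 0 0)\<^sup>2" "dots 0 (w_fps\<^sup>2) 0 = (tau 1 * geo_op (- 1 :: 'k) 0 0)\<^sup>2"
    by (simp_all add: dots_square y_fps_eq w_fps_eq dots_X)
  have nth: "fps_nth y_fps 0 = (0 :: 'k poly)" "fps_nth w_fps 0 = (0 :: 'k poly)"
    by (simp_all add: y_fps_def w_fps_def)
  show "(beta_r :: 'k ab_series) \<otimes>\<^sub>S \<langle>ident 1\<rangle> =
      at_dot (fps_quot (1 - w_fps ^ 2) (1 - y_fps ^ 2)) \<otimes>\<^sub>S beta_r"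
    by (rule beta_slide[OF beta_ser_hom(1) _ d, where \<sigma> = 1 and e = 1])
      (simp_all add: ops_beta_r[OF assms] yw nth)
  show "(beta_l :: 'k ab_series) \<otimes>\<^sub>S \<langle>ident 1\<rangle> =
      at_dot (fps_quot (1 - y_fps ^ 2) (1 - w_fps ^ 2)) \<otimes>\<^sub>S beta_l"
    by (rule beta_slide[OF beta_ser_hom(2) _ e, where \<sigma> = "- 1" and e = "- 1"])
      (simp_all add: ops_beta_l[OF assms] yw nth tau_uminus scal_uminus)
qed

theorem proposition2p5:
  assumes two_invertible: "(2 :: 'k::comm_ring_1) dvd 1"
  shows
    "(beta_l :: 'k ab_series) = -\<^sub>S series_neg_arg beta_r \<and>
     (beta_l :: 'k ab_series) \<circ>\<^sub>S beta_r = -\<^sub>S \<langle>ident 0\<rangle> \<and>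

     (\<langle>ident 1\<rangle> \<otimes>\<^sub>S \<langle>cap\<rangle>) \<circ>\<^sub>S (\<langle>cross\<rangle> \<otimes>\<^sub>S y_ser) \<circ>\<^sub>S (\<langle>ident 1\<rangle> \<otimes>\<^sub>S \<langle>cup\<rangle>) =
       (1 - fps_quot fps_X 2 :: 'k fps) *\<^sub>S (w_ser \<otimes>\<^sub>S beta_r) -\<^sub>S fps_quot fps_X 2 *\<^sub>S y_ser \<and>
     (\<langle>cap\<rangle> \<otimes>\<^sub>S \<langle>ident 1\<rangle>) \<circ>\<^sub>S (y_ser \<otimes>\<^sub>S \<langle>cross\<rangle>) \<circ>\<^sub>S (\<langle>cup\<rangle> \<otimes>\<^sub>S \<langle>ident 1\<rangle>) =
       (- (1 + fps_quot fps_X 2) :: 'k fps) *\<^sub>S (beta_l \<otimes>\<^sub>S w_ser) +\<^sub>S fps_quot fps_X 2 *\<^sub>S y_ser \<and>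

     (\<langle>ident 1\<rangle> \<otimes>\<^sub>S \<langle>cap\<rangle>) \<circ>\<^sub>S (\<langle>cross\<rangle> \<otimes>\<^sub>S w_ser) \<circ>\<^sub>S (\<langle>ident 1\<rangle> \<otimes>\<^sub>S \<langle>cup\<rangle>) =
       (- (1 + fps_quot fps_X 2) :: 'k fps) *\<^sub>S (y_ser \<otimes>\<^sub>S beta_l) +\<^sub>S fps_quot fps_X 2 *\<^sub>S w_ser \<and>
     (\<langle>cap\<rangle> \<otimes>\<^sub>S \<langle>ident 1\<rangle>) \<circ>\<^sub>S (w_ser \<otimes>\<^sub>S \<langle>cross\<rangle>) \<circ>\<^sub>S (\<langle>cup\<rangle> \<otimes>\<^sub>S \<langle>ident 1\<rangle>) =
       (1 - fps_quot fps_X 2 :: 'k fps) *\<^sub>S (beta_r \<otimes>\<^sub>S y_ser) -\<^sub>S fps_quot fps_X 2 *\<^sub>S w_ser \<and>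

     (beta_r :: 'k ab_series) \<otimes>\<^sub>S \<langle>ident 1\<rangle> =
       at_dot (fps_quot (1 - w_fps ^ 2) (1 - y_fps ^ 2)) \<otimes>\<^sub>S beta_r \<and>
     (beta_l :: 'k ab_series) \<otimes>\<^sub>S \<langle>ident 1\<rangle> =
       at_dot (fps_quot (1 - y_fps ^ 2) (1 - w_fps ^ 2)) \<otimes>\<^sub>S beta_l"
  by (intro conjI beta_l_eq beta_l_beta_r curl_right_y curl_left_y curl_right_w curl_left_w beta_slides
      two_invertible)

end
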